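(* Let $k\ge 3$ be an integer and let $S_k=(V_k,E_k)$ be the star with $k$ infinite rays: its vertices are the core $v_0$ and pairwise distinct vertices $v_{j,n}$ for $j\in\{1,\dots,k\}$ and $n\ge 1$, and its edges are $\{v_{j,n},v_{j,n+1}\}$ for $j\in\{1,\dots,k\}$ and $n\ge 0$, where $v_{j,0}$ means $v_0$ for every $j$. Then in $S_k$ all vertices other than the core $v_0$ are dominant, and all vertices (including $v_0$) are non-cyclic.
   Context: For a graph $G=(V,E)$ with countable vertex set and bounded degree, the adjacency operator $A$ is the bounded self-adjoint operator on the complex Hilbert space $\ell^2(V)$ given by $(A\xi)(v)=\sum_{w:\{v,w\}\in E}\xi(w)$; $\delta_v$ is the characteristic function of $\{v\}$. With $\Sigma(A)$ the spectrum of $A$, the local spectral measure $\mu_\xi$ of $A$ at $\xi\in\ell^2(V)$ is the finite positive Borel measure on $\Sigma(A)$ with $\int f\,d\mu_\xi=\langle f(A)\xi\mid\xi\rangle$ for all continuous $f:\Sigma(A)\to\mathbf{C}$. A vertex $v$ is dominant if for every $\eta\in\ell^2(V)$ the measure $\mu_\eta$ is absolutely continuous with respect to $\mu_{\delta_v}$. A vertex $v$ is cyclic if the closed linear span of $\{A^n\delta_v: n\ge 0\}$ is all of $\ell^2(V)$. *)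

theory Defs
  imports "HOL-Analysis.Analysis" "HOL-Computational_Algebra.Polynomial"
begin

section \<open>The complex Hilbert space of square-summable functions\<close>

typedef 'v ell2 = "{\<xi> :: 'v \<Rightarrow> complex. (\<lambda>v. (cmod (\<xi> v))\<^sup>2) summable_on UNIV}"
  morphisms ell2_fun Abs_ell2
  by (rule exI[of _ "\<lambda>_. 0"]) simp

setup_lifting type_definition_ell2

lemma ell2_summable: "(\<lambda>v. (cmod (ell2_fun \<xi> v))\<^sup>2) summable_on UNIV"
  using ell2_fun[of \<xi>] by simp

lemma ell2_eqI: "(\<And>v. ell2_fun \<xi> v = ell2_fun \<eta> v) \<Longrightarrow> \<xi> = \<eta>"
  by (simp add: ell2_fun_inject[symmetric] fun_eq_iff)

lemma ell2_fun_Abs: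
  "(\<lambda>v. (cmod (\<xi> v))\<^sup>2) summable_on UNIV \<Longrightarrow> ell2_fun (Abs_ell2 \<xi>) = \<xi>"
  by (simp add: Abs_ell2_inverse)

lemma square_summable_comb:
  fixes f g :: "'v \<Rightarrow> complex"
  assumes "(\<lambda>v. (cmod (f v))\<^sup>2) summable_on UNIV" "(\<lambda>v. (cmod (g v))\<^sup>2) summable_on UNIV"
    and "\<And>v. cmod (h v) \<le> cmod (f v) + cmod (g v)"
  shows "(\<lambda>v. (cmod (h v))\<^sup>2) summable_on UNIV"
proof (rule summable_on_comparison_test)
  show "(\<lambda>v. 2 * (cmod (f v))\<^sup>2 + 2 * (cmod (g v))\<^sup>2) summable_on UNIV"
    by (intro summable_on_add summable_on_cmult_right assms)
  fix v
  have "(cmod (h v))\<^sup>2 \<le> (cmod (f v) + cmod (g v))\<^sup>2"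
    using assms(3) by (intro power_mono) auto
  also have "\<dots> \<le> 2 * (cmod (f v))\<^sup>2 + 2 * (cmod (g v))\<^sup>2"
    using zero_le_power2[of "cmod (f v) - cmod (g v)"] by (simp add: power2_sum power2_diff)
  finally show "(cmod (h v))\<^sup>2 \<le> 2 * (cmod (f v))\<^sup>2 + 2 * (cmod (g v))\<^sup>2" .
qed auto

instantiation ell2 :: (type) ab_group_add
begin

lift_definition zero_ell2 :: "'a ell2" is "\<lambda>_. 0" by simp
lift_definition plus_ell2 :: "'a ell2 \<Rightarrow> 'a ell2 \<Rightarrow> 'a ell2" is "\<lambda>\<xi> \<eta> v. \<xi> v + \<eta> v"
  by (rule square_summable_comb, assumption, assumption, rule norm_triangle_ineq)
lift_definition minus_ell2 :: "'a ell2 \<Rightarrow> 'a ell2 \<Rightarrow> 'a ell2" is "\<lambda>\<xi> \<eta> v. \<xi> v - \<eta> v"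
  by (rule square_summable_comb, assumption, assumption, rule norm_triangle_ineq4)
lift_definition uminus_ell2 :: "'a ell2 \<Rightarrow> 'a ell2" is "\<lambda>\<xi> v. - \<xi> v" by simp

instance by standard (transfer; simp add: fun_eq_iff)+

end

lift_definition cscale :: "complex \<Rightarrow> 'v ell2 \<Rightarrow> 'v ell2" is "\<lambda>c \<xi> v. c * \<xi> v"
  by (simp add: norm_mult power_mult_distrib summable_on_cmult_right)

interpretation ell2: vector_space cscale
  by standard (transfer; simp add: fun_eq_iff algebra_simps)+

text \<open>The inner product is linear in the first argument.\<close>

definition cinner :: "'v ell2 \<Rightarrow> 'v ell2 \<Rightarrow> complex" where
  "cinner \<xi> \<eta> = (\<Sum>\<^sub>\<infinity>v. ell2_fun \<xi> v * cnj (ell2_fun \<eta> v))"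

lemma cinner_summable: "(\<lambda>v. ell2_fun \<xi> v * cnj (ell2_fun \<eta> v)) summable_on UNIV"
proof (rule abs_summable_summable, rule summable_on_comparison_test)
  show "(\<lambda>v. (cmod (ell2_fun \<xi> v))\<^sup>2 + (cmod (ell2_fun \<eta> v))\<^sup>2) summable_on UNIV"
    by (intro summable_on_add ell2_summable)
  fix v
  have "2 * (cmod (ell2_fun \<xi> v) * cmod (ell2_fun \<eta> v))
      \<le> (cmod (ell2_fun \<xi> v))\<^sup>2 + (cmod (ell2_fun \<eta> v))\<^sup>2"
    using sum_squares_bound[of "cmod (ell2_fun \<xi> v)" "cmod (ell2_fun \<eta> v)"] by simp
  moreover have "0 \<le> cmod (ell2_fun \<xi> v) * cmod (ell2_fun \<eta> v)" by simp
  ultimately show "norm (ell2_fun \<xi> v * cnj (ell2_fun \<eta> v))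
      \<le> (cmod (ell2_fun \<xi> v))\<^sup>2 + (cmod (ell2_fun \<eta> v))\<^sup>2"
    unfolding norm_mult complex_mod_cnj by linarith
qed auto

lemma cinner_self: "cinner \<xi> \<xi> = of_real (\<Sum>\<^sub>\<infinity>v. (cmod (ell2_fun \<xi> v))\<^sup>2)"
proof -
  have "cinner \<xi> \<xi> = (\<Sum>\<^sub>\<infinity>v. of_real ((cmod (ell2_fun \<xi> v))\<^sup>2))"
    unfolding cinner_def by (intro infsum_cong) (simp only: complex_norm_square)
  then show ?thesis
    by (metis infsumI has_sum_infsum has_sum_of_real ell2_summable)
qed

text \<open>The underlying real Hilbert space structure, which supplies the norm and the topology.\<close>

instantiation ell2 :: (type) real_vector
begin

definition scaleR_ell2 :: "real \<Rightarrow> 'a ell2 \<Rightarrow> 'a ell2" where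
  "scaleR_ell2 r \<xi> = cscale (of_real r) \<xi>"

instance
  by standard (simp_all add: scaleR_ell2_def ell2.scale_right_distrib ell2.scale_left_distrib)

end

instantiation ell2 :: (type) real_inner
begin

definition inner_ell2 :: "'a ell2 \<Rightarrow> 'a ell2 \<Rightarrow> real" where
  "inner_ell2 \<xi> \<eta> = Re (cinner \<xi> \<eta>)"
definition norm_ell2 :: "'a ell2 \<Rightarrow> real" where
  "norm_ell2 \<xi> = sqrt (\<Sum>\<^sub>\<infinity>v. (cmod (ell2_fun \<xi> v))\<^sup>2)"
definition sgn_ell2 :: "'a ell2 \<Rightarrow> 'a ell2" where
  "sgn_ell2 \<xi> = \<xi> /\<^sub>R norm \<xi>"
definition dist_ell2 :: "'a ell2 \<Rightarrow> 'a ell2 \<Rightarrow> real" where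
  "dist_ell2 \<xi> \<eta> = norm (\<xi> - \<eta>)"
definition uniformity_ell2 :: "('a ell2 \<times> 'a ell2) filter" where
  "uniformity_ell2 = (INF e\<in>{0<..}. principal {(x, y). dist x y < e})"
definition open_ell2 :: "'a ell2 set \<Rightarrow> bool" where
  "open_ell2 U \<longleftrightarrow> (\<forall>x\<in>U. eventually (\<lambda>(x', y). x' = x \<longrightarrow> y \<in> U) uniformity)"

instance
proof
  fix x y z :: "'a ell2" and r :: real and U :: "'a ell2 set"
  show "sgn x = x /\<^sub>R norm x" "dist x y = norm (x - y)"
    by (simp_all add: sgn_ell2_def dist_ell2_def)
  show "uniformity = (INF e\<in>{0<..}. principal {(x, y :: 'a ell2). dist x y < e})"
    by (simp add: uniformity_ell2_def)
  show "open U = (\<forall>x\<in>U. \<forall>\<^sub>F (x', y) in uniformity. x' = x \<longrightarrow> y \<in> U)"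
    by (simp add: open_ell2_def)
  have "cinner y x = cnj (cinner x y)"
    unfolding cinner_def infsum_cnj[symmetric] by (simp add: mult.commute)
  then show "inner x y = inner y x"
    by (simp add: inner_ell2_def)
  have "cinner (x + y) z = cinner x z + cinner y z"
    unfolding cinner_def by (simp add: plus_ell2.rep_eq distrib_right infsum_add cinner_summable)
  then show "inner (x + y) z = inner x z + inner y z"
    by (simp add: inner_ell2_def)
  have "cinner (cscale (of_real r) x) y = of_real r * cinner x y"
    unfolding cinner_def by (simp add: cscale.rep_eq mult.assoc infsum_cmult_right')
  then show "inner (r *\<^sub>R x) y = r * inner x y"
    by (simp add: inner_ell2_def scaleR_ell2_def)
  show "0 \<le> inner x x"
    by (simp add: inner_ell2_def cinner_self infsum_nonneg)
  show "inner x x = 0 \<longleftrightarrow> x = 0"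
  proof
    assume "inner x x = 0"
    then have *: "(\<Sum>\<^sub>\<infinity>v. (cmod (ell2_fun x v))\<^sup>2) \<le> 0"
      by (simp add: inner_ell2_def cinner_self)
    have "(cmod (ell2_fun x v))\<^sup>2 = 0" for v
      by (rule nonneg_infsum_le_0D[OF * ell2_summable]) auto
    then show "x = 0"
      by (intro ell2_eqI) (simp add: zero_ell2.rep_eq)
  qed (simp add: inner_ell2_def cinner_self zero_ell2.rep_eq)
  show "norm x = sqrt (inner x x)"
    by (simp add: norm_ell2_def inner_ell2_def cinner_self)
qed

end

lemma norm_ell2_sq: "(norm \<xi>)\<^sup>2 = (\<Sum>\<^sub>\<infinity>v. (cmod (ell2_fun \<xi> v))\<^sup>2)" for \<xi> :: "'v ell2"
  by (simp add: norm_ell2_def infsum_nonneg)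

lemma ell2_finite_sum_le:
  "finite F \<Longrightarrow> (\<Sum>v\<in>F. (cmod (ell2_fun \<xi> v))\<^sup>2) \<le> (norm \<xi>)\<^sup>2"
  unfolding norm_ell2_sq by (rule finite_sum_le_infsum[OF ell2_summable]) auto

lemma ell2_bounded_finite_sums:
  fixes f :: "'v \<Rightarrow> complex"
  assumes "\<And>F. finite F \<Longrightarrow> (\<Sum>v\<in>F. (cmod (f v))\<^sup>2) \<le> C\<^sup>2" and "0 \<le> C"
  shows "(\<lambda>v. (cmod (f v))\<^sup>2) summable_on UNIV" and "norm (Abs_ell2 f) \<le> C"
proof -
  show s: "(\<lambda>v. (cmod (f v))\<^sup>2) summable_on UNIV"
    by (rule nonneg_bdd_above_summable_on) (auto intro!: bdd_aboveI2 assms)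
  have "(norm (Abs_ell2 f))\<^sup>2 \<le> C\<^sup>2"
    unfolding norm_ell2_sq ell2_fun_Abs[OF s]
    by (rule infsum_le_finite_sums[OF s]) (auto intro: assms)
  then show "norm (Abs_ell2 f) \<le> C"
    using assms(2) by (rule power2_le_imp_le)
qed

lemma ell2_component_le: "cmod (ell2_fun \<xi> v) \<le> norm \<xi>"
  using ell2_finite_sum_le[of "{v}" \<xi>] by (simp add: power2_le_iff_abs_le)

instance ell2 :: (type) banach
proof
  fix X :: "nat \<Rightarrow> 'a ell2"
  assume X: "Cauchy X"
  have "Cauchy (\<lambda>n. ell2_fun (X n) v)" for v
  proof (rule metric_CauchyI)
    fix e :: real assume "0 < e"
    then obtain M where M: "\<And>m n. m \<ge> M \<Longrightarrow> n \<ge> M \<Longrightarrow> dist (X m) (X n) < e"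
      using X unfolding Cauchy_def by blast
    have "dist (ell2_fun (X m) v) (ell2_fun (X n) v) \<le> dist (X m) (X n)" for m n
      using ell2_component_le[of "X m - X n" v] by (simp add: dist_norm minus_ell2.rep_eq)
    then show "\<exists>M. \<forall>m\<ge>M. \<forall>n\<ge>M. dist (ell2_fun (X m) v) (ell2_fun (X n) v) < e"
      using M by (blast intro: le_less_trans)
  qed
  then have L: "(\<lambda>n. ell2_fun (X n) v) \<longlonglongrightarrow> lim (\<lambda>n. ell2_fun (X n) v)" for v
    using Cauchy_convergent convergent_LIMSEQ_iff by blast
  define L where "L v = lim (\<lambda>n. ell2_fun (X n) v)" for v
  note L = L[folded L_def]
  have *: "(\<lambda>v. (cmod (L v - ell2_fun (X m) v))\<^sup>2) summable_on UNIV \<and>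
           norm (Abs_ell2 (\<lambda>v. L v - ell2_fun (X m) v)) \<le> e"
    if "0 < e" and M: "\<And>n. n \<ge> M \<Longrightarrow> norm (X n - X m) \<le> e" for e m M
  proof -
    have "(\<Sum>v\<in>F. (cmod (L v - ell2_fun (X m) v))\<^sup>2) \<le> e\<^sup>2" if "finite F" for F
    proof (rule tendsto_upperbound)
      show "(\<lambda>n. \<Sum>v\<in>F. (cmod (ell2_fun (X n) v - ell2_fun (X m) v))\<^sup>2)
          \<longlonglongrightarrow> (\<Sum>v\<in>F. (cmod (L v - ell2_fun (X m) v))\<^sup>2)"
        by (intro tendsto_intros L)
      have "(\<Sum>v\<in>F. (cmod (ell2_fun (X n) v - ell2_fun (X m) v))\<^sup>2) \<le> e\<^sup>2" if "n \<ge> M" for n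
        using ell2_finite_sum_le[OF \<open>finite F\<close>, of "X n - X m"]
          power_mono[OF M[OF that], of 2] by (simp add: minus_ell2.rep_eq)
      then show "\<forall>\<^sub>F n in sequentially.
          (\<Sum>v\<in>F. (cmod (ell2_fun (X n) v - ell2_fun (X m) v))\<^sup>2) \<le> e\<^sup>2"
        using eventually_sequentially by blast
    qed auto
    from ell2_bounded_finite_sums[OF this] \<open>0 < e\<close> show ?thesis by simp
  qed
  have unif: "\<exists>M. \<forall>m\<ge>M. \<forall>n\<ge>M. norm (X n - X m) \<le> e" if "0 < e" for e
    using X that unfolding Cauchy_def dist_norm by (blast intro: less_imp_le)
  obtain M where M: "\<And>m n. m \<ge> M \<Longrightarrow> n \<ge> M \<Longrightarrow> norm (X n - X m) \<le> 1"
    using unif[of 1] by auto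
  have "(\<lambda>v. (cmod (L v - ell2_fun (X M) v))\<^sup>2) summable_on UNIV"
    using *[of 1 M M] M by simp
  then have sL: "(\<lambda>v. (cmod (L v))\<^sup>2) summable_on UNIV"
  proof (rule square_summable_comb[OF _ ell2_summable[of "X M"]])
    fix v
    show "cmod (L v) \<le> cmod (L v - ell2_fun (X M) v) + cmod (ell2_fun (X M) v)"
      using norm_triangle_ineq[of "L v - ell2_fun (X M) v" "ell2_fun (X M) v"] by simp
  qed
  have eq: "Abs_ell2 (\<lambda>v. L v - ell2_fun (X m) v) = Abs_ell2 L - X m" for m
    using ell2_fun_inverse[of "Abs_ell2 L - X m"] by (simp add: minus_ell2.rep_eq ell2_fun_Abs[OF sL])
  have "X \<longlonglongrightarrow> Abs_ell2 L"
  proof (rule LIMSEQ_I)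
    fix r :: real assume "0 < r"
    then obtain M where M: "\<And>m n. m \<ge> M \<Longrightarrow> n \<ge> M \<Longrightarrow> norm (X n - X m) \<le> r / 2"
      using unif[of "r / 2"] by auto
    have "norm (X m - Abs_ell2 L) < r" if "m \<ge> M" for m
      using *[of "r / 2" M m] M[OF that] \<open>0 < r\<close> by (simp add: eq norm_minus_commute)
    then show "\<exists>M. \<forall>m\<ge>M. norm (X m - Abs_ell2 L) < r" by blast
  qed
  then show "convergent X" by (rule convergentI)
qed

lift_definition delta :: "'v \<Rightarrow> 'v ell2" is "\<lambda>v w. if w = v then 1 else 0"
  by (rule finite_nonzero_values_imp_summable_on) (simp add: if_distrib cong: if_cong)

section \<open>Operators, functional calculus and local spectral measures\<close>

text \<open>
  Bounded operators are elements of \<^typ>\<open>'v ell2 \<Rightarrow>\<^sub>L 'v ell2\<close> with the operator norm of the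
  library. As this type only enforces real linearity, complex linearity is a separate predicate.
\<close>

type_synonym 'v op = "'v ell2 \<Rightarrow>\<^sub>L 'v ell2"

definition complex_linear :: "'v op \<Rightarrow> bool" where
  "complex_linear T \<longleftrightarrow> (\<forall>c \<xi>. T (cscale c \<xi>) = cscale c (T \<xi>))"

lemma norm_cscale: "norm (cscale c \<xi>) = cmod c * norm \<xi>"
  unfolding norm_ell2_def
  by (simp add: cscale.rep_eq norm_mult power_mult_distrib infsum_cmult_right' real_sqrt_mult)

lift_definition scalar_op :: "complex \<Rightarrow> 'v op" is cscale
proof -
  fix c :: complex
  show "bounded_linear (cscale c :: 'v ell2 \<Rightarrow> 'v ell2)"
    by (rule bounded_linear_intro[where K = "cmod c"])
      (auto simp: ell2.scale_right_distrib scaleR_ell2_def norm_cscale mult.commute)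
qed

definition op_power :: "'v op \<Rightarrow> nat \<Rightarrow> 'v op" where
  "op_power T n = (((o\<^sub>L) T) ^^ n) id_blinfun"

definition op_poly :: "complex poly \<Rightarrow> 'v op \<Rightarrow> 'v op" where
  "op_poly p T = (\<Sum>i\<le>degree p. scalar_op (coeff p i) o\<^sub>L op_power T i)"

definition op_spectrum :: "'v op \<Rightarrow> complex set" where
  "op_spectrum T = {z. \<not> (\<exists>B. complex_linear B \<and>
     (T - scalar_op z) o\<^sub>L B = id_blinfun \<and> B o\<^sub>L (T - scalar_op z) = id_blinfun)}"

text \<open>
  For self-adjoint \<open>T\<close> and continuous \<open>f\<close> on its spectrum, \<open>f(T)\<close> is the norm limit of \<open>p\<^sub>n(T)\<close>
  for every sequence of polynomials \<open>p\<^sub>n\<close> converging to \<open>f\<close> uniformly on the spectrum.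
\<close>

definition cont_fun_calc :: "(complex \<Rightarrow> complex) \<Rightarrow> 'v op \<Rightarrow> 'v op" where
  "cont_fun_calc f T = (THE B. \<forall>p :: nat \<Rightarrow> complex poly.
     uniform_limit (op_spectrum T) (\<lambda>n. poly (p n)) f sequentially \<longrightarrow>
     (\<lambda>n. op_poly (p n) T) \<longlonglongrightarrow> B)"

definition is_local_spectral_measure :: "'v op \<Rightarrow> 'v ell2 \<Rightarrow> complex measure \<Rightarrow> bool" where
  "is_local_spectral_measure T \<xi> \<mu> \<longleftrightarrow>
     finite_measure \<mu> \<and> sets \<mu> = sets (restrict_space borel (op_spectrum T)) \<and>
     (\<forall>f :: complex \<Rightarrow> complex. continuous_on (op_spectrum T) f \<longrightarrow>
        (\<integral>x. f x \<partial>\<mu>) = cinner (cont_fun_calc f T \<xi>) \<xi>)"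

definition local_spectral_measure :: "'v op \<Rightarrow> 'v ell2 \<Rightarrow> complex measure" where
  "local_spectral_measure T \<xi> = (THE \<mu>. is_local_spectral_measure T \<xi> \<mu>)"

section \<open>Adjacency operators, dominant and cyclic vertices\<close>

text \<open>A graph is given by its set of edges \<open>{v, w}\<close>; its vertex set is the whole type.\<close>

definition bounded_degree :: "'v set set \<Rightarrow> bool" where
  "bounded_degree E \<longleftrightarrow> (\<exists>d. \<forall>v. finite {w. {v, w} \<in> E} \<and> card {w. {v, w} \<in> E} \<le> d)"

definition adjacency_op :: "'v set set \<Rightarrow> 'v op" where
  "adjacency_op E = Blinfun (\<lambda>\<xi>. Abs_ell2 (\<lambda>v. \<Sum>w | {v, w} \<in> E. ell2_fun \<xi> w))"

lemma adjacency_op_apply: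
  assumes "bounded_degree E"
  shows "ell2_fun (adjacency_op E \<xi>) v = (\<Sum>w | {v, w} \<in> E. ell2_fun \<xi> w)"
proof -
  obtain d where fin: "\<And>v. finite {w. {v, w} \<in> E}" and d: "\<And>v. card {w. {v, w} \<in> E} \<le> d"
    using assms unfolding bounded_degree_def by blast
  let ?S = "\<lambda>\<xi> v. \<Sum>w | {v, w} \<in> E. ell2_fun \<xi> w"
  have pt: "(cmod (?S \<xi> v))\<^sup>2 \<le> d * (\<Sum>w | {v, w} \<in> E. (cmod (ell2_fun \<xi> w))\<^sup>2)" for \<xi> v
  proof -
    have "(cmod (?S \<xi> v))\<^sup>2 \<le> (\<Sum>w | {v, w} \<in> E. 1 * cmod (ell2_fun \<xi> w))\<^sup>2"
      by (intro power_mono) (auto intro: norm_sum)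
    also have "\<dots> \<le> (\<Sum>w | {v, w} \<in> E. 1\<^sup>2) * (\<Sum>w | {v, w} \<in> E. (cmod (ell2_fun \<xi> w))\<^sup>2)"
      by (rule Cauchy_Schwarz_ineq_sum)
    also have "\<dots> \<le> d * (\<Sum>w | {v, w} \<in> E. (cmod (ell2_fun \<xi> w))\<^sup>2)"
      using d[of v] by (intro mult_right_mono) (auto intro: sum_nonneg)
    finally show ?thesis .
  qed
  have bnd: "(\<Sum>v\<in>F. (cmod (?S \<xi> v))\<^sup>2) \<le> (d * norm \<xi>)\<^sup>2" if F: "finite F" for \<xi> F
  proof -
    let ?W = "\<Union>v\<in>F. {w. {v, w} \<in> E}"
    have "(\<Sum>v\<in>F. (cmod (?S \<xi> v))\<^sup>2)
        \<le> (\<Sum>v\<in>F. d * (\<Sum>w\<in>{w\<in>?W. {v, w} \<in> E}. (cmod (ell2_fun \<xi> w))\<^sup>2))"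
    proof (rule sum_mono)
      fix v assume "v \<in> F"
      then have "{w\<in>?W. {v, w} \<in> E} = {w. {v, w} \<in> E}" by auto
      then show "(cmod (?S \<xi> v))\<^sup>2 \<le> d * (\<Sum>w\<in>{w\<in>?W. {v, w} \<in> E}. (cmod (ell2_fun \<xi> w))\<^sup>2)"
        using pt by simp
    qed
    also have "\<dots> = d * (\<Sum>w\<in>?W. \<Sum>v\<in>{v\<in>F. {v, w} \<in> E}. (cmod (ell2_fun \<xi> w))\<^sup>2)"
      unfolding sum_distrib_left[symmetric] using F fin
      by (subst sum.swap_restrict) auto
    also have "\<dots> \<le> d * (\<Sum>w\<in>?W. d * (cmod (ell2_fun \<xi> w))\<^sup>2)"
    proof (intro mult_left_mono sum_mono)
      fix w
      have "card {v\<in>F. {v, w} \<in> E} \<le> card {v. {w, v} \<in> E}"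
        by (rule card_mono[OF fin]) (auto simp: insert_commute)
      with d[of w] have "card {v\<in>F. {v, w} \<in> E} \<le> d" by linarith
      then show "(\<Sum>v\<in>{v\<in>F. {v, w} \<in> E}. (cmod (ell2_fun \<xi> w))\<^sup>2) \<le> d * (cmod (ell2_fun \<xi> w))\<^sup>2"
        by (simp add: mult_right_mono)
    qed auto
    also have "\<dots> = d\<^sup>2 * (\<Sum>w\<in>?W. (cmod (ell2_fun \<xi> w))\<^sup>2)"
      by (simp add: sum_distrib_left power2_eq_square mult.assoc)
    also have "\<dots> \<le> d\<^sup>2 * (norm \<xi>)\<^sup>2"
      using F fin by (intro mult_left_mono ell2_finite_sum_le) auto
    finally show ?thesis by (simp add: power_mult_distrib)
  qed
  note B = ell2_bounded_finite_sums[OF bnd]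
  have app: "ell2_fun (Abs_ell2 (?S \<xi>)) = ?S \<xi>" for \<xi>
    by (rule ell2_fun_Abs, rule B) auto
  have "bounded_linear (\<lambda>\<xi>. Abs_ell2 (?S \<xi>))"
  proof (rule bounded_linear_intro)
    show "Abs_ell2 (?S (\<xi> + \<eta>)) = Abs_ell2 (?S \<xi>) + Abs_ell2 (?S \<eta>)" for \<xi> \<eta>
      by (rule ell2_eqI, simp only: app, simp add: plus_ell2.rep_eq app sum.distrib)
    show "Abs_ell2 (?S (r *\<^sub>R \<xi>)) = r *\<^sub>R Abs_ell2 (?S \<xi>)" for r \<xi>
      by (rule ell2_eqI, simp only: app, simp add: scaleR_ell2_def cscale.rep_eq app sum_distrib_left)
    show "norm (Abs_ell2 (?S \<xi>)) \<le> norm \<xi> * d" for \<xi>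
      using B(2) by (simp add: mult.commute)
  qed
  then show ?thesis
    by (simp add: adjacency_op_def bounded_linear_Blinfun_apply app)
qed

definition dominant_vertex :: "'v set set \<Rightarrow> 'v \<Rightarrow> bool" where
  "dominant_vertex E v \<longleftrightarrow>
     (\<forall>\<eta>. absolutely_continuous
        (local_spectral_measure (adjacency_op E) (delta v))
        (local_spectral_measure (adjacency_op E) \<eta>))"

definition cyclic_vertex :: "'v set set \<Rightarrow> 'v \<Rightarrow> bool" where
  "cyclic_vertex E v \<longleftrightarrow>
     closure (ell2.span (range (\<lambda>n. op_power (adjacency_op E) n (delta v)))) = UNIV"

section \<open>The star with infinite rays\<close>

text \<open>
  The rays are indexed by a finite type \<open>'k\<close>, so that their number is \<open>CARD('k)\<close>;
  \<open>Ray j n\<close> is the vertex \<open>v\<^bsub>j,n+1\<^esub>\<close>, and \<open>star_vert j n\<close> is \<open>v\<^bsub>j,n\<^esub>\<close>.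
\<close>

datatype 'k star_vertex = Core | Ray 'k nat

fun star_vert :: "'k \<Rightarrow> nat \<Rightarrow> 'k star_vertex" where
  "star_vert j 0 = Core"
| "star_vert j (Suc n) = Ray j n"

definition star_edges :: "'k star_vertex set set" where
  "star_edges = {{star_vert j n, star_vert j (Suc n)} | j n. True}"

lemma star_neighbours_Core: "{w. {Core, w} \<in> star_edges} = range (\<lambda>j :: 'k. Ray j 0)"
proof -
  have "{Core, w} = {star_vert j n, star_vert j (Suc n)} \<longleftrightarrow> n = 0 \<and> w = Ray j 0"
    for w and j :: 'k and n
    by (cases n) (auto simp: doubleton_eq_iff)
  then show ?thesis unfolding star_edges_def by auto
qed

lemma star_neighbours_Ray:
  "{w. {Ray j n, w} \<in> star_edges} = {star_vert (j :: 'k) n, Ray j (Suc n)}"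
proof -
  have "{Ray j n, w} = {star_vert i m, star_vert i (Suc m)} \<longleftrightarrow>
      i = j \<and> (m = n \<and> w = star_vert j n \<or> m = Suc n \<and> w = Ray j (Suc n))"
    for w and i :: 'k and m
    by (cases m) (auto simp: doubleton_eq_iff)
  then show ?thesis unfolding star_edges_def by blast
qed

lemma bounded_degree_star: "bounded_degree (star_edges :: 'k::finite star_vertex set set)"
  unfolding bounded_degree_def
proof (intro exI allI)
  fix v :: "'k star_vertex"
  show "finite {w. {v, w} \<in> star_edges} \<and> card {w. {v, w} \<in> star_edges} \<le> CARD('k) + 2"
  proof (cases v)
    case Core
    then show ?thesis
      using card_image_le[of "UNIV :: 'k set" "\<lambda>j. Ray j 0"] by (simp add: star_neighbours_Core)
  next
    case (Ray j n)
    then show ?thesis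
      using card_insert_le_m1[of 2 "{Ray j (Suc n)}"] by (simp add: star_neighbours_Ray card_insert_if)
  qed
qed

end

(*
  Decompose l^2 of the star into the vectors invariant under permuting the rays and their complement.
  On the complement A acts as copies of the half-line, with generalised eigenfunctions the Chebyshev
  polynomials U_{n-1} and the semicircle law on [-2,2] as spectral measure. On the invariant part A
  is a Jacobi matrix with first weight sqrt k, whose orthogonal polynomials are U_n - (k-1) U_{n-2};
  its measure is absolutely continuous on [-2,2] with two further atoms at k / sqrt (k-1) and its
  negative. Hence every local spectral measure is absolutely continuous with respect to Lebesgue
  measure on [-2,2] plus these two atoms. For a vertex off the core the density is positive almost
  everywhere: the Chebyshev component contributes sin^2 (n t) on [-2,2], and the invariant component
  does not vanish at the atoms.

  A vertex is not cyclic because at least two rays avoid it, and the vectors that agree on these two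
  rays form a proper closed A-invariant subspace containing its delta function.
*)

theory Submission
  imports Defs
begin

section \<open>The complex inner product\<close>

text \<open>\<open>cont_fun_calc\<close> and \<open>local_spectral_measure\<close> are definite
  descriptions over \<open>op_spectrum\<close>, so dominance cannot be addressed before the spectrum
  is known exactly and existence and uniqueness are settled. All of this is extracted from scalar
  data: one measure space over which each vector has a nonnegative density reproducing its moments.
  For a general vector the density is a limit, so no unitary equivalence is built, and the
  eigenfunction family may be redundant: the complement of the invariant vectors is described by k
  components although it consists of k - 1 copies of the half-line.

  Each atom is spread over a unit interval, so that positivity almost everywhere for Lebesgue
  measure treats atoms and continuous spectrum alike.

  The spectral measure of the core is written down explicitly and then verified by orthogonality.
  The verification never evaluates an integral of 1 / (lam^2 - x^2): multiplying by lam^2 - x^2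
  kills both atoms and cancels that factor, which leaves integrals against the semicircle
  law.\<close>

lemma cinner_add_left: "cinner (x + y) z = cinner x z + cinner y z"
  unfolding cinner_def by (simp add: plus_ell2.rep_eq distrib_right infsum_add cinner_summable)

lemma cinner_cscale_left: "cinner (cscale c x) y = c * cinner x y"
  unfolding cinner_def by (simp add: cscale.rep_eq mult.assoc infsum_cmult_right')

lemma cinner_commute: "cinner x y = cnj (cinner y x)"
  unfolding cinner_def infsum_cnj[symmetric] by (simp add: mult.commute)

lemma cinner_add_right: "cinner x (y + z) = cinner x y + cinner x z"
  by (metis cinner_add_left cinner_commute complex_cnj_add)

lemma cinner_cscale_right: "cinner x (cscale c y) = cnj c * cinner x y"
  by (metis cinner_cscale_left cinner_commute complex_cnj_mult)

lemma cinner_zero_left [simp]: "cinner 0 y = 0"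
  using cinner_cscale_left[of 0 0 y] by simp

lemma cinner_zero_right [simp]: "cinner x 0 = 0"
  by (metis cinner_commute cinner_zero_left complex_cnj_zero)

lemma cinner_diff_left: "cinner (x - y) z = cinner x z - cinner y z"
  by (metis add_diff_cancel cinner_add_left diff_add_cancel)

lemma cinner_diff_right: "cinner x (y - z) = cinner x y - cinner x z"
  by (metis add_diff_cancel cinner_add_right diff_add_cancel)

lemma cinner_sum_left: "cinner (sum f F) y = (\<Sum>v\<in>F. cinner (f v) y)"
  by (induction F rule: infinite_finite_induct) (auto simp: cinner_add_left)

lemma cinner_sum_right: "cinner y (sum f F) = (\<Sum>v\<in>F. cinner y (f v))"
  by (induction F rule: infinite_finite_induct) (auto simp: cinner_add_right)

lemma cinner_eq_norm: "cinner x x = of_real ((norm x)\<^sup>2)"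
  by (simp add: cinner_self norm_ell2_sq)

text \<open>The real Cauchy-Schwarz inequality controls the real part and, with \<open>x\<close>
  multiplied by \<open>- \<i>\<close>, the imaginary part. The factor 2 is harmless, since only
  continuity of \<open>cinner\<close> is drawn from it.\<close>

lemma cmod_cinner_le: "cmod (cinner x y) \<le> 2 * norm x * norm y"
proof -
  have *: "\<bar>Re (cinner x y)\<bar> \<le> norm x * norm y" for x y :: "'a ell2"
    using Cauchy_Schwarz_ineq2[of x y] by (simp add: inner_ell2_def)
  have "Im (cinner x y) = Re (cinner (cscale (- \<i>) x) y)"
    by (simp add: cinner_cscale_left del: ell2.scale_minus_left)
  then have "\<bar>Im (cinner x y)\<bar> \<le> norm x * norm y"
    using *[of "cscale (- \<i>) x" y] by (simp add: norm_cscale)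
  then show ?thesis
    using *[of x y] cmod_le[of "cinner x y"] by linarith
qed

lemma tendsto_cinner:
  assumes "(f \<longlongrightarrow> x) F" "(g \<longlongrightarrow> y) F"
  shows "((\<lambda>n. cinner (f n) (g n)) \<longlongrightarrow> cinner x y) F"
proof -
  have "((\<lambda>n. 2 * norm (f n - x) * norm (g n) + 2 * norm x * norm (g n - y)) \<longlongrightarrow>
      2 * norm (x - x) * norm y + 2 * norm x * norm (y - y)) F"
    by (intro tendsto_intros assms)
  then have lim: "((\<lambda>n. 2 * norm (f n - x) * norm (g n) + 2 * norm x * norm (g n - y)) \<longlongrightarrow> 0) F"
    by simp
  have "norm (cinner (f n) (g n) - cinner x y)
      \<le> 2 * norm (f n - x) * norm (g n) + 2 * norm x * norm (g n - y)" for n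
  proof -
    have "cinner (f n) (g n) - cinner x y = cinner (f n - x) (g n) + cinner x (g n - y)"
      by (simp add: cinner_diff_left cinner_diff_right)
    then show ?thesis
      using norm_triangle_ineq[of "cinner (f n - x) (g n)" "cinner x (g n - y)"]
        cmod_cinner_le[of "f n - x" "g n"] cmod_cinner_le[of x "g n - y"] by simp
  qed
  then have "((\<lambda>n. cinner (f n) (g n) - cinner x y) \<longlongrightarrow> 0) F"
    by (intro Lim_null_comparison[OF _ lim] always_eventually allI)
  then show ?thesis
    by (rule LIM_zero_cancel)
qed

lemma ell2_fun_sum: "ell2_fun (sum f F) v = (\<Sum>w\<in>F. ell2_fun (f w) v)"
  by (induction F rule: infinite_finite_induct) (auto simp: plus_ell2.rep_eq zero_ell2.rep_eq)

lemma ell2_fun_delta: "ell2_fun (delta v) w = (if w = v then 1 else 0)"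
  by transfer simp

lemma cinner_delta_right: "cinner x (delta v) = ell2_fun x v"
proof -
  have "cinner x (delta v) = (\<Sum>\<^sub>\<infinity>w. if w = v then ell2_fun x v else 0)"
    unfolding cinner_def by (intro infsum_cong) (simp add: ell2_fun_delta)
  also have "\<dots> = (\<Sum>\<^sub>\<infinity>w\<in>{v}. ell2_fun x v)"
    by (rule infsum_cong_neutral) auto
  finally show ?thesis by simp
qed

section \<open>Approximation by finitely supported vectors\<close>

definition finite_supp :: "'v ell2 \<Rightarrow> bool" where
  "finite_supp x \<longleftrightarrow> finite {v. ell2_fun x v \<noteq> 0}"

lemma finite_supp_expand:
  assumes "finite F" "{v. ell2_fun x v \<noteq> 0} \<subseteq> F"
  shows "x = (\<Sum>v\<in>F. cscale (ell2_fun x v) (delta v))"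
proof (rule ell2_eqI)
  fix v
  show "ell2_fun x v = ell2_fun (\<Sum>v\<in>F. cscale (ell2_fun x v) (delta v)) v"
    using assms
    by (auto simp: ell2_fun_sum cscale.rep_eq ell2_fun_delta if_distrib[of "(*) _"] cong: if_cong)
qed

lemma finite_supp_diff: "finite_supp x \<Longrightarrow> finite_supp y \<Longrightarrow> finite_supp (x - y)"
  unfolding finite_supp_def
  by (rule finite_subset[of _ "{v. ell2_fun x v \<noteq> 0} \<union> {v. ell2_fun y v \<noteq> 0}"])
    (auto simp: minus_ell2.rep_eq)

lemma finite_supp_delta: "finite_supp (delta v)"
  unfolding finite_supp_def by (simp add: ell2_fun_delta)

lemma finite_supp_dense:
  assumes "0 < e"
  shows "\<exists>y. finite_supp y \<and> norm (x - y) < e"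
proof -
  let ?f = "\<lambda>v. (cmod (ell2_fun x v))\<^sup>2"
  have "(?f has_sum (norm x)\<^sup>2) UNIV"
    unfolding norm_ell2_sq by (rule has_sum_infsum[OF ell2_summable])
  from tendstoD[OF this[unfolded has_sum_def], of "e\<^sup>2"] assms
  obtain F where F: "finite F" "dist (sum ?f F) ((norm x)\<^sup>2) < e\<^sup>2"
    unfolding eventually_finite_subsets_at_top by (auto 0 3)
  define y where "y = (\<Sum>v\<in>F. cscale (ell2_fun x v) (delta v))"
  have y: "ell2_fun y v = (if v \<in> F then ell2_fun x v else 0)" for v
    using F by (auto simp: y_def ell2_fun_sum cscale.rep_eq ell2_fun_delta
      if_distrib[of "(*) _"] cong: if_cong)
  have "(norm (x - y))\<^sup>2 = (\<Sum>\<^sub>\<infinity>v\<in>UNIV - F. ?f v)"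
    unfolding norm_ell2_sq by (rule infsum_cong_neutral) (auto simp: minus_ell2.rep_eq y)
  also have "\<dots> = (norm x)\<^sup>2 - sum ?f F"
    unfolding norm_ell2_sq using F by (subst infsum_Diff[OF ell2_summable]) auto
  also have "\<dots> < e\<^sup>2"
    using F(2) by (simp add: dist_real_def)
  finally have "norm (x - y) < e"
    using assms power_less_imp_less_base[of "norm (x - y)" 2 e] by simp
  moreover have "finite_supp y"
    unfolding finite_supp_def by (rule finite_subset[OF _ F(1)]) (auto simp: y)
  ultimately show ?thesis by blast
qed

text \<open>The rate is left open: self-adjointness is content with any null sequence, the densities
  call for a geometric one.\<close>

lemma finite_supp_seq:
  assumes "\<And>n. 0 < (e n :: real)"
  obtains y where "\<And>n :: nat. finite_supp (y n)" "\<And>n. norm (x - y n) < e n"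
proof -
  have "\<forall>n. \<exists>y. finite_supp y \<and> norm (x - y) < e n"
    using finite_supp_dense[OF assms] by blast
  from choice[OF this] show thesis
    using that by blast
qed

section \<open>Polynomials of an operator\<close>

lemma op_power_0 [simp]: "op_power T 0 = id_blinfun"
  by (simp add: op_power_def)

lemma op_power_Suc: "op_power T (Suc n) = T o\<^sub>L op_power T n"
  by (simp add: op_power_def)

lemma op_power_Suc': "op_power T (Suc n) = op_power T n o\<^sub>L T"
  proof (induction n)
  case (Suc n)
  have "op_power T (Suc (Suc n)) = T o\<^sub>L (op_power T n o\<^sub>L T)"
    by (simp only: op_power_Suc[of T "Suc n"] Suc)
  then show ?case
    by (intro blinfun_eqI) (simp add: op_power_Suc)
qed (rule blinfun_eqI, simp add: op_power_Suc)

lemma scalar_op_apply [simp]: "scalar_op c x = cscale c x"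
  by (simp add: scalar_op.rep_eq)

lemma op_poly_bound:
  assumes "degree p \<le> n"
  shows "op_poly p T = (\<Sum>i\<le>n. scalar_op (coeff p i) o\<^sub>L op_power T i)"
  unfolding op_poly_def using assms
  by (intro sum.mono_neutral_left) (auto simp: coeff_eq_0 intro!: blinfun_eqI)

lemma op_poly_apply:
  assumes "degree p \<le> n"
  shows "op_poly p T x = (\<Sum>i\<le>n. cscale (coeff p i) (op_power T i x))"
  by (simp add: op_poly_bound[OF assms] blinfun.sum_left)

lemma op_poly_add: "op_poly (p + q) T = op_poly p T + op_poly q T"
proof (rule blinfun_eqI)
  fix x
  let ?n = "max (degree p) (degree q)"
  show "op_poly (p + q) T x = (op_poly p T + op_poly q T) x"
    using degree_add_le_max[of p q]
    by (simp add: plus_blinfun.rep_eq op_poly_apply[where n = ?n] sum.distrib ell2.scale_left_distrib)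
qed

lemma op_poly_smult: "op_poly (smult c p) T = scalar_op c o\<^sub>L op_poly p T"
  by (rule blinfun_eqI) (simp add: op_poly_apply[where n = "degree p"] ell2.scale_sum_right)

lemma op_poly_diff: "op_poly (p - q) T = op_poly p T - op_poly q T"
  using op_poly_add[of "p - q" q T] by simp

lemma op_poly_0 [simp]: "op_poly 0 T = 0"
  using op_poly_diff[of 0 0 T] by simp

lemma op_poly_pCons: "op_poly (pCons a p) T = scalar_op a + (op_poly p T o\<^sub>L T)"
proof (rule blinfun_eqI)
  fix x
  have "op_poly (pCons a p) T x = (\<Sum>i\<le>Suc (degree p). cscale (coeff (pCons a p) i) (op_power T i x))"
    by (rule op_poly_apply) (simp add: degree_pCons_le)
  also have "\<dots> = cscale a x + (\<Sum>i\<le>degree p. cscale (coeff p i) (op_power T (Suc i) x))"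
    by (subst sum.atMost_Suc_shift) simp
  finally show "op_poly (pCons a p) T x = (scalar_op a + (op_poly p T o\<^sub>L T)) x"
    by (simp add: plus_blinfun.rep_eq op_poly_apply[where n = "degree p"] op_power_Suc')
qed

lemma op_poly_const: "op_poly [:a:] T = scalar_op a"
  by (simp add: op_poly_pCons)

lemma op_poly_1 [simp]: "op_poly 1 T = id_blinfun"
  unfolding one_pCons op_poly_const by (rule blinfun_eqI) simp

lemma complex_linear_op_poly:
  assumes "complex_linear T"
  shows "complex_linear (op_poly p T)"
proof (induction p)
  case 0
  show ?case by (simp add: complex_linear_def zero_blinfun.rep_eq)
next
  case (pCons a p)
  then show ?case using assms
    by (simp add: op_poly_pCons complex_linear_def plus_blinfun.rep_eq ell2.scale_right_distrib
      ell2.scale_left_commute mult.commute)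
qed

text \<open>Elements of \<open>'v op\<close> are only real linear, so moving \<open>T\<close> past
  the coefficients takes \<open>complex_linear T\<close>.\<close>

lemma op_poly_commute:
  assumes "complex_linear T"
  shows "op_poly p T o\<^sub>L T = T o\<^sub>L op_poly p T"
proof (induction p)
  case 0
  show ?case by (rule blinfun_eqI) (simp add: zero_blinfun.rep_eq)
next
  case (pCons a p)
  have "op_poly p T (T x) = T (op_poly p T x)" for x
    using arg_cong[OF pCons(2), of "\<lambda>f. blinfun_apply f x"] by simp
  then show ?case using assms
    by (intro blinfun_eqI) (simp add: op_poly_pCons complex_linear_def plus_blinfun.rep_eq blinfun.add_right)
qed

lemma op_poly_mult:
  assumes "complex_linear T"
  shows "op_poly (p * q) T = op_poly p T o\<^sub>L op_poly q T"
proof (induction p)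
  case 0
  show ?case by (rule blinfun_eqI) (simp add: zero_blinfun.rep_eq)
next
  case (pCons a p)
  have "op_poly q T (T x) = T (op_poly q T x)" for x
    using arg_cong[OF op_poly_commute[OF assms, of q], of "\<lambda>f. blinfun_apply f x"] by simp
  then show ?case
    by (intro blinfun_eqI)
      (simp add: op_poly_pCons op_poly_add op_poly_smult pCons(2) plus_blinfun.rep_eq)
qed

text \<open>At real points the polynomial with conjugated coefficients takes the conjugate values
  (\<open>poly_map_cnj_of_real\<close>). This is what turns the squared norm of p(T)x into an
  integral of |p|^2.\<close>

lemma op_poly_adjoint:
  assumes "complex_linear T" and "\<And>x y. cinner (T x) y = cinner x (T y)"
  shows "cinner (op_poly p T x) y = cinner x (op_poly (map_poly cnj p) T y)"
proof (induction p arbitrary: x y)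
  case 0
  show ?case by (simp add: zero_blinfun.rep_eq)
next
  case (pCons a p)
  have *: "op_poly r T (T x) = T (op_poly r T x)" for r x
    using arg_cong[OF op_poly_commute[OF assms(1), of r], of "\<lambda>f. blinfun_apply f x"] by simp
  have "map_poly cnj (pCons a p) = pCons (cnj a) (map_poly cnj p)"
    by (cases "a = 0 \<and> p = 0") (auto simp: map_poly_pCons)
  then show ?case
    by (simp add: op_poly_pCons plus_blinfun.rep_eq cinner_add_left cinner_add_right * assms(2)
      cinner_cscale_left cinner_cscale_right pCons(2))
qed

text \<open>\<open>op_spectrum\<close> admits only complex linear inverses. The inverse of T - z
  will arise as a norm limit of polynomials in T and inherits its linearity from them.\<close>

lemma complex_linear_limit:
  assumes "f \<longlonglongrightarrow> B" and "\<And>n. complex_linear (f n :: 'v op)"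
  shows "complex_linear B"
  unfolding complex_linear_def
proof (intro allI)
  fix c x
  have cont: "isCont (cscale c :: 'v ell2 \<Rightarrow> 'v ell2) y" for y
    using linear_continuous_at[OF blinfun.bounded_linear_right, of y "scalar_op c"] by simp
  have 1: "(\<lambda>n. f n (cscale c x)) \<longlonglongrightarrow> B (cscale c x)"
    by (intro tendsto_intros blinfun.tendsto assms)
  have "(\<lambda>n. f n x) \<longlonglongrightarrow> B x"
    by (intro tendsto_intros blinfun.tendsto assms)
  then have "(\<lambda>n. cscale c (f n x)) \<longlonglongrightarrow> cscale c (B x)"
    by (rule isCont_tendsto_compose[OF cont])
  then have "(\<lambda>n. f n (cscale c x)) \<longlonglongrightarrow> cscale c (B x)"
    using assms(2) by (simp add: complex_linear_def)
  with 1 show "B (cscale c x) = cscale c (B x)"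
    by (rule LIMSEQ_unique)
qed

section \<open>Uniqueness of measures and polynomial approximation\<close>

text \<open>Tent functions of slope n in the distance to \<open>C\<close> decrease to the indicator
  of \<open>C\<close> and are dominated by 1. For empty \<open>C\<close> the convention
  \<open>infdist x {} = 0\<close> would make every tent constantly 1.\<close>

lemma tendsto_measure_closed:
  fixes \<mu> :: "'a::metric_space measure"
  assumes "finite_measure \<mu>" "sets \<mu> = sets (restrict_space borel K)" "closed C" "C \<noteq> {}"
  shows "(\<lambda>n. \<integral>x. complex_of_real (max 0 (1 - real n * infdist x C)) \<partial>\<mu>)
      \<longlonglongrightarrow> complex_of_real (measure \<mu> (C \<inter> space \<mu>))"
proof -
  interpret finite_measure \<mu> by fact
  have m: "f \<in> borel_measurable \<mu>" if "f \<in> borel_measurable borel" for f :: "'a \<Rightarrow> real"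
    unfolding measurable_cong_sets[OF assms(2) refl] using that by (rule measurable_restrict_space1)
  have C: "C \<inter> space \<mu> \<in> sets \<mu>"
    unfolding assms(2) sets_eq_imp_space_eq[OF assms(2)] sets_restrict_space space_restrict_space
    by (rule image_eqI[of _ _ C]) (use assms(3) in auto)
  have "(\<lambda>n. \<integral>x. max 0 (1 - real n * infdist x C) \<partial>\<mu>) \<longlonglongrightarrow> (\<integral>x. indicator (C \<inter> space \<mu>) x \<partial>\<mu>)"
  proof (rule integral_dominated_convergence[where w = "\<lambda>_. 1"])
    show "AE x in \<mu>. (\<lambda>n. max 0 (1 - real n * infdist x C)) \<longlonglongrightarrow> indicator (C \<inter> space \<mu>) x"
    proof (rule AE_I2)
      fix x assume x: "x \<in> space \<mu>"
      show "(\<lambda>n. max 0 (1 - real n * infdist x C)) \<longlonglongrightarrow> indicator (C \<inter> space \<mu>) x"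
      proof (cases "x \<in> C")
        case False
        then have pos: "0 < infdist x C"
          using assms(3,4) infdist_nonneg[of x C] in_closed_iff_infdist_zero[of C x] by fastforce
        obtain N where N: "1 < real N * infdist x C"
          using reals_Archimedean3[OF pos] by blast
        have "max 0 (1 - real n * infdist x C) = 0" if "N \<le> n" for n
        proof -
          have "real N * infdist x C \<le> real n * infdist x C"
            using that pos by (intro mult_right_mono) auto
          then show ?thesis using N by simp
        qed
        then have "\<forall>\<^sub>F n in sequentially. max 0 (1 - real n * infdist x C) = 0"
          using eventually_sequentially by blast
        then show ?thesis using False by (simp add: tendsto_eventually)
      qed (use x in simp)
    qed
    have "(\<lambda>x. max 0 (1 - real n * infdist x C)) \<in> borel_measurable borel" for n
      by (intro borel_measurable_continuous_onI continuous_intros)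
    then show "(\<lambda>x. max 0 (1 - real n * infdist x C)) \<in> borel_measurable \<mu>" for n
      by (rule m)
    have "0 \<le> real n * infdist x C" for n x
      by (simp add: infdist_nonneg)
    then show "AE x in \<mu>. norm (max 0 (1 - real n * infdist x C)) \<le> 1" for n
      by (intro AE_I2) (simp add: max_def)
  qed (use C in auto)
  then have "(\<lambda>n. complex_of_real (\<integral>x. max 0 (1 - real n * infdist x C) \<partial>\<mu>)) 
      \<longlonglongrightarrow> complex_of_real (\<integral>x. indicator (C \<inter> space \<mu>) x \<partial>\<mu>)"
    by (rule tendsto_of_real)
  then show ?thesis using C by simp
qed

text \<open>Uniqueness behind the definite description in \<open>local_spectral_measure\<close>:
  continuous functions determine the measure of closed sets, which form a generating
  \<pi>-system.\<close>

lemma finite_measure_eqI_continuous: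
  fixes \<mu> \<nu> :: "'a::metric_space measure"
  assumes "finite_measure \<mu>" "finite_measure \<nu>"
    and sets: "sets \<mu> = sets (restrict_space borel K)" "sets \<nu> = sets (restrict_space borel K)"
    and eq: "\<And>f :: 'a \<Rightarrow> complex. continuous_on K f \<Longrightarrow> (\<integral>x. f x \<partial>\<mu>) = (\<integral>x. f x \<partial>\<nu>)"
  shows "\<mu> = \<nu>"
proof -
  interpret \<mu>: finite_measure \<mu> by fact
  interpret \<nu>: finite_measure \<nu> by fact
  have sp: "space \<mu> = K" "space \<nu> = K"
    using sets_eq_imp_space_eq[OF sets(1)] sets_eq_imp_space_eq[OF sets(2)]
    by (auto simp: space_restrict_space)
  have m: "(\<lambda>x. x) \<in> measurable \<mu> borel" "(\<lambda>x. x) \<in> measurable \<nu> borel"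
    unfolding measurable_cong_sets[OF sets(1) refl] measurable_cong_sets[OF sets(2) refl]
    by (auto intro: measurable_restrict_space1)
  have closed: "emeasure \<mu> (C \<inter> K) = emeasure \<nu> (C \<inter> K)" if "closed C" for C
  proof (cases "C = {}")
    case False
    have "continuous_on K (\<lambda>x. complex_of_real (max 0 (1 - real n * infdist x C)))" for n
      by (intro continuous_intros)
    note eq = eq[OF this]
    have "complex_of_real (measure \<mu> (C \<inter> K)) = complex_of_real (measure \<nu> (C \<inter> K))"
      using tendsto_measure_closed[OF assms(1) sets(1) that False]
        tendsto_measure_closed[OF assms(2) sets(2) that False]
      unfolding eq sp by (rule LIMSEQ_unique)
    then show ?thesis
      by (simp add: \<mu>.emeasure_eq_measure \<nu>.emeasure_eq_measure)
  qed simp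
  \<comment> \<open>The two measures live on the Borel sets restricted to \<open>K\<close>; pushed
    forward to \<open>borel\<close>, they can be compared on the closed sets of the whole
    space.\<close>
  have "distr \<mu> borel (\<lambda>x. x) = distr \<nu> borel (\<lambda>x. x)"
  proof (rule measure_eqI_generator_eq[where E = "Collect closed" and \<Omega> = UNIV and A = "\<lambda>_. UNIV"])
    show "sets (distr \<mu> borel (\<lambda>x. x)) = sigma_sets UNIV (Collect closed)"
      "sets (distr \<nu> borel (\<lambda>x. x)) = sigma_sets UNIV (Collect closed)"
      by (simp_all add: borel_eq_closed)
    show "emeasure (distr \<mu> borel (\<lambda>x. x)) C = emeasure (distr \<nu> borel (\<lambda>x. x)) C" if "C \<in> Collect closed" for C
      using that closed by (simp add: emeasure_distr m sp)
  qed (auto simp: Int_stable_def emeasure_distr m)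
  then have *: "emeasure \<mu> (C \<inter> K) = emeasure \<nu> (C \<inter> K)" if "C \<in> sets borel" for C
    using that emeasure_distr[OF m(1) that] emeasure_distr[OF m(2) that] by (simp add: sp)
  show ?thesis
  proof (rule measure_eqI)
    fix C assume "C \<in> sets \<mu>"
    then obtain C' where "C' \<in> sets borel" "C = C' \<inter> K"
      unfolding sets(1) by (auto simp: sets_restrict_space)
    then show "emeasure \<mu> C = emeasure \<nu> C" using * by simp
  qed (simp add: sets)
qed

text \<open>On a subset of the real line, real Weierstrass approximation of Re f and Im f is enough;
  the two polynomials are recombined as p + i q.\<close>

lemma poly_uniform_approx:
  fixes f :: "complex \<Rightarrow> complex"
  assumes "compact X" "continuous_on (complex_of_real ` X) f"
  obtains p where "uniform_limit (complex_of_real ` X) (\<lambda>n. poly (p n)) f sequentially"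
proof -
  have "\<exists>p. \<forall>x\<in>X. cmod (poly p (complex_of_real x) - f (complex_of_real x)) < e" if "0 < e" for e
  proof -
    have poly: "\<exists>p. \<forall>x\<in>X. cmod (poly p (complex_of_real x) - of_real (h (complex_of_real x))) < e / 2"
      if h: "continuous_on (complex_of_real ` X) h" for h :: "complex \<Rightarrow> real"
    proof -
      have "continuous_on X (\<lambda>x. h (complex_of_real x))"
        by (intro continuous_on_compose2[OF h] continuous_intros) auto
      from Stone_Weierstrass_real_polynomial_function[OF \<open>compact X\<close> this, of "e / 2"] \<open>0 < e\<close>
      obtain g where g: "real_polynomial_function g"
        "\<And>x. x \<in> X \<Longrightarrow> \<bar>h (complex_of_real x) - g x\<bar> < e / 2" by auto
      obtain a n where a: "g = (\<lambda>x. \<Sum>i\<le>n. a i * x ^ i)"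
        using g(1) real_polynomial_function_iff_sum by blast
      let ?p = "\<Sum>i\<le>n. monom (complex_of_real (a i)) i"
      have "poly ?p (complex_of_real x) = of_real (g x)" for x
        by (simp add: poly_sum poly_monom a)
      then have "cmod (poly ?p (complex_of_real x) - of_real (h (complex_of_real x))) < e / 2"
        if "x \<in> X" for x
        using g(2)[OF that] by (simp add: abs_minus_commute flip: of_real_diff)
      then show ?thesis by blast
    qed
    obtain p q where
      p: "\<And>x. x \<in> X \<Longrightarrow> cmod (poly p (complex_of_real x) - of_real (Re (f (complex_of_real x)))) < e / 2"
      and q: "\<And>x. x \<in> X \<Longrightarrow> cmod (poly q (complex_of_real x) - of_real (Im (f (complex_of_real x)))) < e / 2"
      using poly[OF continuous_on_Re[OF assms(2)]] poly[OF continuous_on_Im[OF assms(2)]] by blast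
    have "cmod (poly (p + smult \<i> q) (complex_of_real x) - f (complex_of_real x)) < e" if "x \<in> X" for x
    proof -
      let ?z = "f (complex_of_real x)"
      have "poly (p + smult \<i> q) (complex_of_real x) - ?z
          = (poly p (complex_of_real x) - of_real (Re ?z)) + \<i> * (poly q (complex_of_real x) - of_real (Im ?z))"
        by (simp add: complex_eq_iff)
      then have "cmod (poly (p + smult \<i> q) (complex_of_real x) - ?z)
          = cmod ((poly p (complex_of_real x) - of_real (Re ?z)) + \<i> * (poly q (complex_of_real x) - of_real (Im ?z)))"
        by (rule arg_cong)
      then show ?thesis
        using norm_triangle_ineq[of "poly p (complex_of_real x) - of_real (Re ?z)"
            "\<i> * (poly q (complex_of_real x) - of_real (Im ?z))"] p[OF that] q[OF that]
        unfolding norm_mult by simp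
    qed
    then show ?thesis by blast
  qed
  then have "\<forall>n. \<exists>p. \<forall>x\<in>X. cmod (poly p (complex_of_real x) - f (complex_of_real x)) < inverse (Suc n)"
    by simp
  from choice[OF this] obtain p where
    p: "\<And>n x. x \<in> X \<Longrightarrow> cmod (poly (p n) (complex_of_real x) - f (complex_of_real x)) < inverse (Suc n)"
    by blast
  have "uniform_limit (complex_of_real ` X) (\<lambda>n. poly (p n)) f sequentially"
  proof (rule uniform_limitI)
    fix e :: real assume "0 < e"
    with LIMSEQ_inverse_real_of_nat have "\<forall>\<^sub>F n in sequentially. inverse (Suc n) < e"
      by (rule order_tendstoD)
    then show "\<forall>\<^sub>F n in sequentially. \<forall>x\<in>complex_of_real ` X. dist (poly (p n) x) (f x) < e"
      by eventually_elim (use p in \<open>force simp: dist_norm intro: less_trans\<close>)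
  qed
  then show thesis using that by blast
qed

lemma poly_map_cnj_of_real: "poly (map_poly cnj p) (complex_of_real x) = cnj (poly p (complex_of_real x))"
proof (induction p)
  case (pCons a p)
  then show ?case
    by (cases "a = 0 \<and> p = 0") (auto simp: map_poly_pCons)
qed simp

section \<open>Operators with spectral densities\<close>

text \<open>The image under \<Phi> of the measure with density \<open>D\<close> is going to be the
  spectral measure of \<open>x\<close>. The identity is stated for polynomials because these make
  sense before any functional calculus. Nonnegativity is demanded at every point.\<close>

definition spectral_density :: "'v op \<Rightarrow> 'a measure \<Rightarrow> ('a \<Rightarrow> real) \<Rightarrow> 'v ell2 \<Rightarrow> ('a \<Rightarrow> real) \<Rightarrow> bool" where
  "spectral_density T M \<Phi> x D \<longleftrightarrow> integrable M D \<and> (\<forall>t\<in>space M. 0 \<le> D t) \<and>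
     (\<forall>p. cinner (op_poly p T x) x = (\<integral>t. poly p (complex_of_real (\<Phi> t)) * complex_of_real (D t) \<partial>M))"

text \<open>A scalar substitute for the spectral theorem: the densities of different vectors share M
  and \<Phi> but need not be related otherwise. \<open>essential\<close> says that near each point
  of \<open>X\<close> some vector has spectral mass, which keeps \<open>X\<close> from exceeding the
  spectrum.\<close>

locale spectral_representation =
  fixes T :: "'v op" and M :: "'a measure" and \<Phi> :: "'a \<Rightarrow> real" and X :: "real set"
  assumes lin: "complex_linear T"
    and self_adjoint: "cinner (T x) y = cinner x (T y)"
    and compact_X: "compact X"
    and \<Phi>_measurable [measurable]: "\<Phi> \<in> borel_measurable M"
    and \<Phi>_in: "t \<in> space M \<Longrightarrow> \<Phi> t \<in> X"
    and ex_density: "\<exists>D. spectral_density T M \<Phi> x D"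
    and essential: "s \<in> X \<Longrightarrow> 0 < e \<Longrightarrow>
      \<exists>x D. spectral_density T M \<Phi> x D \<and> \<not> (AE t in M. \<bar>\<Phi> t - s\<bar> < e \<longrightarrow> D t = 0)"
begin

abbreviation "K \<equiv> complex_of_real ` X"

lemma compact_K: "compact K"
  by (intro compact_continuous_image compact_X continuous_intros)

lemma of_real_\<Phi>_measurable: "(\<lambda>t. complex_of_real (\<Phi> t)) \<in> measurable M (restrict_space borel K)"
  using \<Phi>_in by (intro measurable_restrict_space2) auto

lemma comp_\<Phi>_measurable:
  assumes "continuous_on K (f :: complex \<Rightarrow> complex)"
  shows "(\<lambda>t. f (complex_of_real (\<Phi> t))) \<in> borel_measurable M"
  using measurable_compose[OF of_real_\<Phi>_measurable borel_measurable_continuous_on_restrict[OF assms]] .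

lemma integrable_continuous:
  assumes f: "continuous_on K (f :: complex \<Rightarrow> complex)" and D: "integrable M D"
  shows "integrable M (\<lambda>t. f (complex_of_real (\<Phi> t)) * complex_of_real (D t))"
proof -
  obtain b where b: "\<And>z. z \<in> K \<Longrightarrow> cmod (f z) \<le> b"
    using compact_imp_bounded[OF compact_continuous_image[OF f compact_K]]
    unfolding bounded_iff by blast
  show ?thesis
  proof (rule Bochner_Integration.integrable_bound)
    show "integrable M (\<lambda>t. b * D t)" using D by simp
    show "(\<lambda>t. f (complex_of_real (\<Phi> t)) * complex_of_real (D t)) \<in> borel_measurable M"
      using comp_\<Phi>_measurable[OF f] borel_measurable_integrable[OF D] by measurable
    show "AE t in M. cmod (f (complex_of_real (\<Phi> t)) * complex_of_real (D t)) \<le> norm (b * D t)"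
    proof (rule AE_I2)
      fix t assume "t \<in> space M"
      then have "cmod (f (complex_of_real (\<Phi> t))) \<le> \<bar>b\<bar>" using b \<Phi>_in by fastforce
      then show "cmod (f (complex_of_real (\<Phi> t)) * complex_of_real (D t)) \<le> norm (b * D t)"
        by (simp add: norm_mult abs_mult mult_right_mono)
    qed
  qed
qed

lemma integral_uniform_limit:
  assumes lim: "uniform_limit K g f sequentially"
    and g: "\<And>n. continuous_on K (g n)" and f: "continuous_on K (f :: complex \<Rightarrow> complex)"
    and D: "integrable M D" "\<And>t. t \<in> space M \<Longrightarrow> 0 \<le> D t"
  shows "(\<lambda>n. \<integral>t. g n (complex_of_real (\<Phi> t)) * complex_of_real (D t) \<partial>M)
     \<longlonglongrightarrow> (\<integral>t. f (complex_of_real (\<Phi> t)) * complex_of_real (D t) \<partial>M)"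
proof (rule LIMSEQ_I)
  fix r :: real assume r: "0 < r"
  define I where "I = (\<integral>t. D t \<partial>M)"
  have I: "0 \<le> I" unfolding I_def using D(2) by (intro integral_nonneg_AE AE_I2) auto
  \<comment> \<open>Adding 1 covers the case of total mass \<open>I = 0\<close>.\<close>
  define e where "e = r / (I + 1)"
  have e: "0 < e" "e * I < r" using r I by (auto simp: e_def field_simps)
  have "\<forall>\<^sub>F n in sequentially. \<forall>z\<in>K. dist (g n z) (f z) < e"
    using lim e by (simp add: uniform_limit_iff)
  then obtain N where N: "\<And>n z. N \<le> n \<Longrightarrow> z \<in> K \<Longrightarrow> dist (g n z) (f z) < e"
    unfolding eventually_sequentially by blast
  have "norm ((\<integral>t. g n (complex_of_real (\<Phi> t)) * complex_of_real (D t) \<partial>M)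
      - (\<integral>t. f (complex_of_real (\<Phi> t)) * complex_of_real (D t) \<partial>M)) < r" if n: "N \<le> n" for n
  proof -
    let ?h = "\<lambda>t. (g n (complex_of_real (\<Phi> t)) - f (complex_of_real (\<Phi> t))) * complex_of_real (D t)"
    have int: "integrable M ?h"
      using integrable_continuous[OF continuous_on_diff[OF g f] D(1)] .
    have "norm (integral\<^sup>L M ?h) \<le> (\<integral>t. norm (?h t) \<partial>M)" by simp
    also have "\<dots> \<le> (\<integral>t. e * D t \<partial>M)"
    proof (rule integral_mono)
      fix t assume t: "t \<in> space M"
      have "cmod (g n (complex_of_real (\<Phi> t)) - f (complex_of_real (\<Phi> t))) \<le> e"
        using N[OF n, of "complex_of_real (\<Phi> t)"] \<Phi>_in[OF t] by (auto simp: dist_norm)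
      then show "norm (?h t) \<le> e * D t"
        using D(2)[OF t] by (simp add: norm_mult mult_right_mono)
    qed (use int D in auto)
    also have "\<dots> < r" using e by (simp add: I_def)
    finally show ?thesis
      using integrable_continuous[OF g D(1)] integrable_continuous[OF f D(1)]
      by (simp add: left_diff_distrib)
  qed
  then show "\<exists>N. \<forall>n\<ge>N. norm ((\<integral>t. g n (complex_of_real (\<Phi> t)) * complex_of_real (D t) \<partial>M)
      - (\<integral>t. f (complex_of_real (\<Phi> t)) * complex_of_real (D t) \<partial>M)) < r" by blast
qed

lemma norm_op_poly_sq:
  assumes "spectral_density T M \<Phi> x D"
  shows "complex_of_real ((norm (op_poly p T x))\<^sup>2)
    = (\<integral>t. poly p (complex_of_real (\<Phi> t)) * cnj (poly p (complex_of_real (\<Phi> t))) * complex_of_real (D t) \<partial>M)"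
proof -
  have "complex_of_real ((norm (op_poly p T x))\<^sup>2) = cinner (op_poly p T x) (op_poly p T x)"
    by (simp add: cinner_eq_norm)
  also have "\<dots> = cinner (op_poly (map_poly cnj p) T (op_poly p T x)) x"
    by (subst cinner_commute, subst op_poly_adjoint[OF lin self_adjoint], subst cinner_commute) simp
  also have "\<dots> = cinner (op_poly (map_poly cnj p * p) T x) x"
    by (simp add: op_poly_mult[OF lin])
  also have "\<dots> = (\<integral>t. poly (map_poly cnj p * p) (complex_of_real (\<Phi> t)) * complex_of_real (D t) \<partial>M)"
    using assms unfolding spectral_density_def by blast
  finally show ?thesis
    by (simp add: poly_map_cnj_of_real mult.commute)
qed

text \<open>By \<open>norm_op_poly_sq\<close> the squared norm of p(T)x is at most sup |p|^2 times
  the mass of the density, and p = 1 identifies that mass as the squared norm of \<open>x\<close>.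
  So p(T) depends continuously on p in the sup norm over \<open>K\<close>, before the spectrum is
  known.\<close>

lemma norm_op_poly_le:
  assumes "0 \<le> c" "\<And>z. z \<in> K \<Longrightarrow> cmod (poly p z) \<le> c"
  shows "norm (op_poly p T) \<le> c"
proof (rule norm_blinfun_bound[OF assms(1)])
  fix x
  obtain D where D: "spectral_density T M \<Phi> x D" using ex_density by blast
  then have intD: "integrable M D" and D0: "\<And>t. t \<in> space M \<Longrightarrow> 0 \<le> D t"
    unfolding spectral_density_def by auto
  have "complex_of_real ((norm x)\<^sup>2) = complex_of_real (\<integral>t. D t \<partial>M)"
    using norm_op_poly_sq[OF D, of 1] by simp
  then have nx: "(norm x)\<^sup>2 = (\<integral>t. D t \<partial>M)" by (simp only: of_real_eq_iff)
  let ?h = "\<lambda>t. poly p (complex_of_real (\<Phi> t)) * cnj (poly p (complex_of_real (\<Phi> t))) * complex_of_real (D t)"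
  have int: "integrable M ?h"
    by (rule integrable_continuous[OF _ intD]) (intro continuous_intros)
  have "(norm (op_poly p T x))\<^sup>2 = cmod (integral\<^sup>L M ?h)"
    unfolding norm_op_poly_sq[OF D, symmetric] norm_of_real by simp
  also have "\<dots> \<le> (\<integral>t. norm (?h t) \<partial>M)" by simp
  also have "\<dots> \<le> (\<integral>t. c\<^sup>2 * D t \<partial>M)"
  proof (rule integral_mono)
    fix t assume t: "t \<in> space M"
    have "cmod (poly p (complex_of_real (\<Phi> t))) \<le> c" using assms \<Phi>_in[OF t] by auto
    then have "(cmod (poly p (complex_of_real (\<Phi> t))))\<^sup>2 \<le> c\<^sup>2" by (intro power_mono) auto
    then show "norm (?h t) \<le> c\<^sup>2 * D t"
      using D0[OF t] by (simp add: norm_mult power2_eq_square mult_right_mono)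
  qed (use int intD in auto)
  also have "\<dots> = (c * norm x)\<^sup>2" by (simp add: nx power_mult_distrib)
  finally show "norm (op_poly p T x) \<le> c * norm x"
    using assms(1) by (simp add: power2_le_iff_abs_le)
qed

text \<open>\<open>cont_fun_calc\<close> quantifies over all approximating sequences. The difference
  of two of them tends to 0 uniformly on \<open>K\<close>, so one convergent sequence decides for
  all.\<close>

lemma op_poly_limit_unique:
  assumes "uniform_limit K (\<lambda>n. poly (p n)) f sequentially" "uniform_limit K (\<lambda>n. poly (q n)) f sequentially"
    and "(\<lambda>n. op_poly (q n) T) \<longlonglongrightarrow> B"
  shows "(\<lambda>n. op_poly (p n) T) \<longlonglongrightarrow> B"
proof -
  have "uniform_limit K (\<lambda>n z. poly (p n) z - poly (q n) z) (\<lambda>z. f z - f z) sequentially"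
    by (intro uniform_limit_intros assms)
  then have lim: "uniform_limit K (\<lambda>n. poly (p n - q n)) (\<lambda>z. 0) sequentially"
    by (simp add: poly_diff[abs_def])
  have "(\<lambda>n. op_poly (p n - q n) T) \<longlonglongrightarrow> 0"
  proof (rule LIMSEQ_I)
    fix r :: real assume "0 < r"
    then have "\<forall>\<^sub>F n in sequentially. \<forall>z\<in>K. dist (poly (p n - q n) z) 0 < r / 2"
      by (intro uniform_limitD[OF lim]) simp
    then obtain N where N: "\<And>n z. N \<le> n \<Longrightarrow> z \<in> K \<Longrightarrow> cmod (poly (p n - q n) z) < r / 2"
      unfolding eventually_sequentially by (auto simp: dist_norm)
    have "norm (op_poly (p n - q n) T) \<le> r / 2" if "N \<le> n" for n
      using N[OF that] \<open>0 < r\<close> by (intro norm_op_poly_le) (auto intro: less_imp_le)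
    then show "\<exists>N. \<forall>n\<ge>N. norm (op_poly (p n - q n) T - 0) < r"
      using \<open>0 < r\<close> by (intro exI[of _ N]) force
  qed
  from tendsto_add[OF this assms(3)] show ?thesis by (simp add: op_poly_diff)
qed

lemma op_poly_convergent:
  assumes "uniform_limit K (\<lambda>n. poly (p n)) f sequentially"
  obtains B where "(\<lambda>n. op_poly (p n) T) \<longlonglongrightarrow> B"
proof -
  have "Cauchy (\<lambda>n. op_poly (p n) T)"
  proof (rule CauchyI)
    fix e :: real assume e: "0 < e"
    then have "\<forall>\<^sub>F n in sequentially. \<forall>z\<in>K. dist (poly (p n) z) (f z) < e / 4"
      by (intro uniform_limitD[OF assms]) simp
    then obtain N where N: "\<And>n z. N \<le> n \<Longrightarrow> z \<in> K \<Longrightarrow> dist (poly (p n) z) (f z) < e / 4"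
      unfolding eventually_sequentially by blast
    have "norm (op_poly (p m - p n) T) \<le> e / 2" if "N \<le> m" "N \<le> n" for m n
    proof (rule norm_op_poly_le)
      fix z assume z: "z \<in> K"
      show "cmod (poly (p m - p n) z) \<le> e / 2"
        using dist_triangle2[of "poly (p m) z" "poly (p n) z" "f z"] N[OF that(1) z] N[OF that(2) z]
        by (simp add: dist_norm)
    qed (use e in simp)
    then show "\<exists>N. \<forall>m\<ge>N. \<forall>n\<ge>N. norm (op_poly (p m) T - op_poly (p n) T) < e"
      using e by (intro exI[of _ N]) (force simp: op_poly_diff)
  qed
  then show thesis
    using that Cauchy_convergent convergent_def by blast
qed

section \<open>Identification of the spectrum\<close>

lemma uniform_limit_poly_mult:
  assumes "uniform_limit K (\<lambda>n. poly (p n)) f sequentially" "continuous_on K f"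
  shows "uniform_limit K (\<lambda>n. poly (q * p n)) (\<lambda>z. poly q z * f z) sequentially"
proof -
  have "bounded (poly q ` K)" "bounded (f ` K)"
    using assms(2) by (auto intro!: compact_imp_bounded compact_continuous_image compact_K continuous_intros)
  then show ?thesis
    unfolding poly_mult[abs_def]
    by (intro uniform_lim_mult assms uniform_limit_const)
qed

text \<open>For z off \<open>K\<close>, the function 1 / (w - z) is a uniform limit of polynomials
  on \<open>K\<close>, and the limit of these polynomials in \<open>T\<close> inverts T - z on both
  sides.\<close>

lemma spectrum_subset: "op_spectrum T \<subseteq> K"
proof
  fix z assume z: "z \<in> op_spectrum T"
  show "z \<in> K"
  proof (rule ccontr)
    assume zK: "z \<notin> K"
    have cont: "continuous_on K (\<lambda>w. 1 / (w - z))"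
      using zK by (intro continuous_intros) auto
    obtain p where p: "uniform_limit K (\<lambda>n. poly (p n)) (\<lambda>w. 1 / (w - z)) sequentially"
      using poly_uniform_approx[OF compact_X cont] .
    obtain B where B: "(\<lambda>n. op_poly (p n) T) \<longlonglongrightarrow> B"
      using op_poly_convergent[OF p] .
    let ?q = "[:- z, 1:] :: complex poly"
    have q: "op_poly ?q T = T - scalar_op z"
      by (rule blinfun_eqI) (simp add: op_poly_pCons plus_blinfun.rep_eq minus_blinfun.rep_eq)
    have "uniform_limit K (\<lambda>n. poly (?q * p n)) (\<lambda>w. 1) sequentially
        \<longleftrightarrow> uniform_limit K (\<lambda>n. poly (?q * p n)) (\<lambda>w. poly ?q w * (1 / (w - z))) sequentially"
      using zK by (intro uniform_limit_cong') auto
    then have "uniform_limit K (\<lambda>n. poly (?q * p n)) (\<lambda>w. 1) sequentially"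
      using uniform_limit_poly_mult[OF p cont] by blast
    then have lim: "(\<lambda>n. op_poly (?q * p n) T) \<longlonglongrightarrow> id_blinfun"
      by (rule op_poly_limit_unique[where q = "\<lambda>_. 1"]) (auto simp: poly_1[abs_def] intro: uniform_limit_const)
    have "(\<lambda>n. op_poly (?q * p n) T) \<longlonglongrightarrow> ((T - scalar_op z) o\<^sub>L B)"
      unfolding op_poly_mult[OF lin] q
      by (intro bounded_bilinear.tendsto[OF bounded_bilinear_blinfun_compose] tendsto_const B)
    then have 1: "(T - scalar_op z) o\<^sub>L B = id_blinfun"
      using LIMSEQ_unique[OF _ lim] by blast
    have "(\<lambda>n. op_poly (?q * p n) T) \<longlonglongrightarrow> (B o\<^sub>L (T - scalar_op z))"
      unfolding mult.commute[of ?q] op_poly_mult[OF lin] q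
      by (intro bounded_bilinear.tendsto[OF bounded_bilinear_blinfun_compose] tendsto_const B)
    then have 2: "B o\<^sub>L (T - scalar_op z) = id_blinfun"
      using LIMSEQ_unique[OF _ lim] by blast
    have "complex_linear B"
      using complex_linear_limit[OF B] complex_linear_op_poly[OF lin] by blast
    with 1 2 z show False unfolding op_spectrum_def by blast
  qed
qed

text \<open>A bounded inverse would give a lower bound for T - z. It is violated on G(T)x, where G
  is a tent at s so narrow that T - z nearly annihilates such vectors, and x is a vector with
  spectral mass under the tent.\<close>

lemma subset_spectrum: "K \<subseteq> op_spectrum T"
proof
  fix z assume "z \<in> K"
  then obtain s where s: "s \<in> X" "z = complex_of_real s" by blast
  show "z \<in> op_spectrum T"
  proof (rule ccontr)
    assume "z \<notin> op_spectrum T"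
    then obtain B where B: "B o\<^sub>L (T - scalar_op z) = id_blinfun"
      unfolding op_spectrum_def by blast
    define c where "c = norm B + 1"
    have c: "0 < c" by (simp add: c_def add_nonneg_pos)
    have below: "norm y \<le> c * norm ((T - scalar_op z) y)" for y
    proof -
      have "norm y = norm (B ((T - scalar_op z) y))"
        using arg_cong[OF B, of "\<lambda>f. blinfun_apply f y"] by simp
      also have "\<dots> \<le> norm B * norm ((T - scalar_op z) y)" by (rule norm_blinfun)
      also have "\<dots> \<le> c * norm ((T - scalar_op z) y)"
        by (intro mult_right_mono) (auto simp: c_def)
      finally show ?thesis .
    qed
    \<comment> \<open>Within distance \<open>e\<close> of \<open>s\<close> the product of
      \<open>c\<close> and |\<Phi> - s| is at most 1/2. Squared, this yields the factor 1/4 below,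
      and a nonnegative integral bounded by a quarter of itself is 0.\<close>
    define e where "e = 1 / (2 * c)"
    have e: "0 < e" using c by (simp add: e_def)
    obtain x D where D: "spectral_density T M \<Phi> x D"
      and nD: "\<not> (AE t in M. \<bar>\<Phi> t - s\<bar> < e \<longrightarrow> D t = 0)"
      using essential[OF s(1) e] by blast
    from D have intD: "integrable M D" and D0: "\<And>t. t \<in> space M \<Longrightarrow> 0 \<le> D t"
      unfolding spectral_density_def by auto
    define g where "g w = max 0 (e - \<bar>Re w - s\<bar>)" for w :: complex
    define G where "G w = complex_of_real (g w)" for w
    have G: "continuous_on K G"
      unfolding G_def g_def by (intro continuous_intros)
    obtain p where p: "uniform_limit K (\<lambda>n. poly (p n)) G sequentially"
      using poly_uniform_approx[OF compact_X G] .
    let ?q = "[:- z, 1:] :: complex poly"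
    have q: "op_poly ?q T = T - scalar_op z"
      by (rule blinfun_eqI) (simp add: op_poly_pCons plus_blinfun.rep_eq minus_blinfun.rep_eq)
    have lim: "(\<lambda>n. complex_of_real ((norm (op_poly (r n) T x))\<^sup>2))
        \<longlonglongrightarrow> (\<integral>t. H (complex_of_real (\<Phi> t)) * cnj (H (complex_of_real (\<Phi> t))) * complex_of_real (D t) \<partial>M)"
      if r: "uniform_limit K (\<lambda>n. poly (r n)) H sequentially" and H: "continuous_on K H" for r H
      unfolding norm_op_poly_sq[OF D]
    proof (rule integral_uniform_limit[OF _ _ _ intD D0])
      have "bounded (H ` K)" "bounded ((\<lambda>w. cnj (H w)) ` K)"
        using H by (auto intro!: compact_imp_bounded compact_continuous_image compact_K continuous_intros)
      then show "uniform_limit K (\<lambda>n w. poly (r n) w * cnj (poly (r n) w)) (\<lambda>w. H w * cnj (H w)) sequentially"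
        by (intro uniform_lim_mult r bounded_linear.uniform_limit[OF bounded_linear_cnj])
    qed (use H in \<open>auto intro!: continuous_intros\<close>)
    have lim1: "(\<lambda>n. (norm (op_poly (p n) T x))\<^sup>2) \<longlonglongrightarrow> (\<integral>t. (g (complex_of_real (\<Phi> t)))\<^sup>2 * D t \<partial>M)"
    proof -
      have "(\<integral>t. G (complex_of_real (\<Phi> t)) * cnj (G (complex_of_real (\<Phi> t))) * complex_of_real (D t) \<partial>M)
          = (\<integral>t. complex_of_real ((g (complex_of_real (\<Phi> t)))\<^sup>2 * D t) \<partial>M)"
        by (simp add: G_def power2_eq_square)
      then show ?thesis
        using lim[OF p G] by (simp only: integral_complex_of_real tendsto_of_real_iff)
    qed
    have lim2: "(\<lambda>n. (norm (op_poly (?q * p n) T x))\<^sup>2)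
        \<longlonglongrightarrow> (\<integral>t. (\<Phi> t - s)\<^sup>2 * (g (complex_of_real (\<Phi> t)))\<^sup>2 * D t \<partial>M)"
    proof -
      have "(\<integral>t. (poly ?q (complex_of_real (\<Phi> t)) * G (complex_of_real (\<Phi> t)))
            * cnj (poly ?q (complex_of_real (\<Phi> t)) * G (complex_of_real (\<Phi> t))) * complex_of_real (D t) \<partial>M)
          = (\<integral>t. complex_of_real ((\<Phi> t - s)\<^sup>2 * (g (complex_of_real (\<Phi> t)))\<^sup>2 * D t) \<partial>M)"
        by (intro Bochner_Integration.integral_cong) (auto simp: G_def power2_eq_square s algebra_simps)
      moreover have "continuous_on K (\<lambda>w. poly ?q w * G w)"
        by (intro continuous_intros G)
      ultimately show ?thesis
        using lim[OF uniform_limit_poly_mult[OF p G, of ?q]]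
        by (simp only: integral_complex_of_real tendsto_of_real_iff)
    qed
    have int: "integrable M (\<lambda>t. h (complex_of_real (\<Phi> t)) * D t)" if "continuous_on K h" for h :: "complex \<Rightarrow> real"
    proof -
      have "integrable M (\<lambda>t. complex_of_real (h (complex_of_real (\<Phi> t)) * D t))"
        using integrable_continuous[OF _ intD, of "\<lambda>w. complex_of_real (h w)"] that
        by (simp add: continuous_on_of_real)
      then show ?thesis by (simp only: complex_of_real_integrable_eq)
    qed
    have gc: "continuous_on K g" unfolding g_def by (intro continuous_intros)
    have int1: "integrable M (\<lambda>t. (g (complex_of_real (\<Phi> t)))\<^sup>2 * D t)"
      by (rule int) (intro continuous_intros gc)
    have int2: "integrable M (\<lambda>t. (\<Phi> t - s)\<^sup>2 * (g (complex_of_real (\<Phi> t)))\<^sup>2 * D t)"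
      using int[of "\<lambda>w. (Re w - s)\<^sup>2 * (g w)\<^sup>2"] gc by (simp add: continuous_intros)
    have "(\<integral>t. (g (complex_of_real (\<Phi> t)))\<^sup>2 * D t \<partial>M)
        \<le> c\<^sup>2 * (\<integral>t. (\<Phi> t - s)\<^sup>2 * (g (complex_of_real (\<Phi> t)))\<^sup>2 * D t \<partial>M)"
    proof (rule LIMSEQ_le[OF lim1 tendsto_mult[OF tendsto_const lim2]], intro exI[of _ 0] allI impI)
      fix n
      have "norm (op_poly (p n) T x) \<le> c * norm (op_poly (?q * p n) T x)"
        using below[of "op_poly (p n) T x"] by (simp only: op_poly_mult[OF lin] q blinfun_apply_blinfun_compose)
      then show "(norm (op_poly (p n) T x))\<^sup>2 \<le> c\<^sup>2 * (norm (op_poly (?q * p n) T x))\<^sup>2"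
        unfolding power_mult_distrib[symmetric] by (rule power_mono) simp
    qed
    also have "\<dots> = (\<integral>t. c\<^sup>2 * ((\<Phi> t - s)\<^sup>2 * (g (complex_of_real (\<Phi> t)))\<^sup>2 * D t) \<partial>M)" by simp
    also have "\<dots> \<le> (\<integral>t. (1 / 4) * ((g (complex_of_real (\<Phi> t)))\<^sup>2 * D t) \<partial>M)"
    proof (rule integral_mono)
      fix t assume t: "t \<in> space M"
      show "c\<^sup>2 * ((\<Phi> t - s)\<^sup>2 * (g (complex_of_real (\<Phi> t)))\<^sup>2 * D t) \<le> (1 / 4) * ((g (complex_of_real (\<Phi> t)))\<^sup>2 * D t)"
      proof (cases "\<bar>\<Phi> t - s\<bar> < e")
        case True
        then have "c * \<bar>\<Phi> t - s\<bar> \<le> 1 / 2" using c by (simp add: e_def field_simps)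
        then have "(c * \<bar>\<Phi> t - s\<bar>)\<^sup>2 \<le> (1 / 2)\<^sup>2" using c by (intro power_mono) auto
        then have "c\<^sup>2 * (\<Phi> t - s)\<^sup>2 \<le> 1 / 4" by (simp add: power_mult_distrib power_divide)
        from mult_right_mono[OF this, of "(g (complex_of_real (\<Phi> t)))\<^sup>2 * D t"] D0[OF t]
        show ?thesis by (simp add: mult.assoc)
      qed (simp add: g_def)
    qed (use int1 int2 in auto)
    also have "\<dots> = (1 / 4) * (\<integral>t. (g (complex_of_real (\<Phi> t)))\<^sup>2 * D t \<partial>M)" by simp
    finally have "(\<integral>t. (g (complex_of_real (\<Phi> t)))\<^sup>2 * D t \<partial>M) \<le> 0" by simp
    moreover have nn: "AE t in M. 0 \<le> (g (complex_of_real (\<Phi> t)))\<^sup>2 * D t"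
      using D0 by (intro AE_I2) simp
    ultimately have "(\<integral>t. (g (complex_of_real (\<Phi> t)))\<^sup>2 * D t \<partial>M) = 0"
      using integral_nonneg_AE[OF nn] by linarith
    then have "AE t in M. (g (complex_of_real (\<Phi> t)))\<^sup>2 * D t = 0"
      using integral_nonneg_eq_0_iff_AE[OF int1 nn] by blast
    then have "AE t in M. \<bar>\<Phi> t - s\<bar> < e \<longrightarrow> D t = 0"
      by eventually_elim (auto simp: g_def)
    with nD show False by blast
  qed
qed

lemma spectrum_eq: "op_spectrum T = K"
  using spectrum_subset subset_spectrum by blast

section \<open>Functional calculus and local spectral measures from densities\<close>

lemma cont_fun_calc_limit:
  assumes "uniform_limit K (\<lambda>n. poly (p n)) f sequentially"
  shows "(\<lambda>n. op_poly (p n) T) \<longlonglongrightarrow> cont_fun_calc f T"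
proof -
  obtain B where B: "(\<lambda>n. op_poly (p n) T) \<longlonglongrightarrow> B"
    using op_poly_convergent[OF assms] .
  have "cont_fun_calc f T = B"
    unfolding cont_fun_calc_def spectrum_eq
  proof (rule the_equality)
    show "\<forall>p. uniform_limit K (\<lambda>n. poly (p n)) f sequentially \<longrightarrow> (\<lambda>n. op_poly (p n) T) \<longlonglongrightarrow> B"
      using op_poly_limit_unique[OF _ assms B] by blast
  qed (use assms B LIMSEQ_unique in blast)
  with B show ?thesis by simp
qed

definition lsm :: "('a \<Rightarrow> real) \<Rightarrow> complex measure" where
  "lsm D = distr (density M (\<lambda>t. ennreal (D t))) (restrict_space borel K) (\<lambda>t. complex_of_real (\<Phi> t))"

lemma is_local_spectral_measure_lsm:
  assumes D: "spectral_density T M \<Phi> x D"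
  shows "is_local_spectral_measure T x (lsm D)"
proof -
  from D have intD: "integrable M D" and D0: "\<And>t. t \<in> space M \<Longrightarrow> 0 \<le> D t"
    and Dp: "\<And>p. cinner (op_poly p T x) x = (\<integral>t. poly p (complex_of_real (\<Phi> t)) * complex_of_real (D t) \<partial>M)"
    unfolding spectral_density_def by auto
  note [measurable] = borel_measurable_integrable[OF intD]
  note m = of_real_\<Phi>_measurable
  have m': "(\<lambda>t. complex_of_real (\<Phi> t)) \<in> measurable (density M (\<lambda>t. ennreal (D t))) (restrict_space borel K)"
    using m by simp
  have "emeasure (density M (\<lambda>t. ennreal (D t))) (space M) = (\<integral>\<^sup>+t. ennreal (D t) \<partial>M)"
    by (subst emeasure_density) (auto intro!: nn_integral_cong)
  also have "\<dots> < \<infinity>"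
    using intD D0 by (subst nn_integral_eq_integral) (auto intro: AE_I2)
  finally have "finite_measure (density M (\<lambda>t. ennreal (D t)))"
    by (intro finite_measureI) simp
  then have fin: "finite_measure (lsm D)"
    unfolding lsm_def using m' by (rule finite_measure.finite_measure_distr)
  have "(\<integral>w. f w \<partial>lsm D) = cinner (cont_fun_calc f T x) x" if f: "continuous_on K f" for f
  proof -
    note fm = borel_measurable_continuous_on_restrict[OF f]
    have "(\<integral>w. f w \<partial>lsm D) = (\<integral>t. f (complex_of_real (\<Phi> t)) \<partial>density M (\<lambda>t. ennreal (D t)))"
      unfolding lsm_def by (rule integral_distr[OF m' fm])
    also have "\<dots> = (\<integral>t. f (complex_of_real (\<Phi> t)) * complex_of_real (D t) \<partial>M)"
      using D0 comp_\<Phi>_measurable[OF f]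
      by (subst integral_density) (auto intro!: AE_I2 simp: scaleR_conv_of_real mult.commute)
    finally have 1: "(\<integral>w. f w \<partial>lsm D) = (\<integral>t. f (complex_of_real (\<Phi> t)) * complex_of_real (D t) \<partial>M)" .
    obtain p where p: "uniform_limit K (\<lambda>n. poly (p n)) f sequentially"
      using poly_uniform_approx[OF compact_X f] .
    have "(\<lambda>n. cinner (op_poly (p n) T x) x) \<longlonglongrightarrow> cinner (cont_fun_calc f T x) x"
      by (intro tendsto_cinner tendsto_const blinfun.tendsto cont_fun_calc_limit[OF p])
    moreover have "(\<lambda>n. cinner (op_poly (p n) T x) x) \<longlonglongrightarrow> (\<integral>t. f (complex_of_real (\<Phi> t)) * complex_of_real (D t) \<partial>M)"
      unfolding Dp by (rule integral_uniform_limit[OF p _ f intD D0]) (intro continuous_intros)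
    ultimately show ?thesis unfolding 1 using LIMSEQ_unique by blast
  qed
  then show ?thesis
    using fin unfolding is_local_spectral_measure_def spectrum_eq by (simp add: lsm_def)
qed

lemma local_spectral_measure_eq:
  assumes D: "spectral_density T M \<Phi> x D"
  shows "local_spectral_measure T x = lsm D"
  unfolding local_spectral_measure_def
proof (rule the_equality)
  show "is_local_spectral_measure T x (lsm D)"
    by (rule is_local_spectral_measure_lsm[OF D])
next
  fix \<mu> assume "is_local_spectral_measure T x \<mu>"
  then show "\<mu> = lsm D"
    using is_local_spectral_measure_lsm[OF D]
    unfolding is_local_spectral_measure_def spectrum_eq
    by (intro finite_measure_eqI_continuous[where K = K]) auto
qed

text \<open>If \<open>D\<close> is positive almost everywhere, a null set of \<open>lsm D\<close>
  has an M-null preimage under \<Phi>; every other local spectral measure is the image of a density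
  over the same M.\<close>

lemma absolutely_continuous_local_spectral_measure:
  assumes D: "spectral_density T M \<Phi> x D" and pos: "AE t in M. 0 < D t"
  shows "absolutely_continuous (local_spectral_measure T x) (local_spectral_measure T y)"
proof -
  obtain D' where D': "spectral_density T M \<Phi> y D'" using ex_density by blast
  have [measurable]: "D \<in> borel_measurable M" "D' \<in> borel_measurable M"
    using D D' unfolding spectral_density_def by auto
  have m: "(\<lambda>t. complex_of_real (\<Phi> t)) \<in> measurable (density M (\<lambda>t. ennreal (d t))) (restrict_space borel K)" for d
    using of_real_\<Phi>_measurable by simp
  have "N \<in> null_sets (lsm D')" if "N \<in> null_sets (lsm D)" for N
  proof -
    let ?A = "(\<lambda>t. complex_of_real (\<Phi> t)) -` N \<inter> space M"
    from that have N: "N \<in> sets (restrict_space borel K)"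
      and A: "?A \<in> sets M" and AE: "AE t in M. t \<in> ?A \<longrightarrow> ennreal (D t) = 0"
      unfolding lsm_def by (auto simp: null_sets_distr_iff[OF m] null_sets_density_iff)
    from AE pos have "AE t in M. t \<in> ?A \<longrightarrow> ennreal (D' t) = 0"
      by eventually_elim (auto simp: ennreal_eq_0_iff)
    then show ?thesis
      using N A unfolding lsm_def by (auto simp: null_sets_distr_iff[OF m] null_sets_density_iff)
  qed
  then show ?thesis
    unfolding absolutely_continuous_def local_spectral_measure_eq[OF D] local_spectral_measure_eq[OF D'] by blast
qed

end

section \<open>Eigenfunction expansions of adjacency operators\<close>

lemma adjacency_op_delta:
  assumes "bounded_degree E"
  shows "adjacency_op E (delta v) = (\<Sum>w | {v, w} \<in> E. delta w)"
proof (rule ell2_eqI)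
  fix u
  have fin: "finite {w. {a, w} \<in> E}" for a
    using assms unfolding bounded_degree_def by blast
  have "{u, v} \<in> E \<longleftrightarrow> {v, u} \<in> E" by (simp add: insert_commute)
  then show "ell2_fun (adjacency_op E (delta v)) u = ell2_fun (\<Sum>w | {v, w} \<in> E. delta w) u"
    using fin by (simp add: adjacency_op_apply[OF assms] ell2_fun_sum ell2_fun_delta)
qed

lemma complex_linear_adjacency_op:
  assumes "bounded_degree E"
  shows "complex_linear (adjacency_op E)"
  unfolding complex_linear_def
  by (intro allI ell2_eqI) (simp add: adjacency_op_apply[OF assms] cscale.rep_eq sum_distrib_left)

text \<open>Against \<open>delta v\<close> both sides are the neighbour sum of \<open>x\<close> at
  \<open>v\<close>. Linearity extends this to finitely supported \<open>y\<close>, continuity to all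
  \<open>y\<close>.\<close>

lemma adjacency_op_self_adjoint:
  assumes "bounded_degree E"
  shows "cinner (adjacency_op E x) y = cinner x (adjacency_op E y)"
proof -
  let ?A = "adjacency_op E"
  have delta: "cinner (?A x) (delta v) = cinner x (?A (delta v))" for v
    by (simp add: adjacency_op_delta[OF assms] cinner_sum_right cinner_delta_right adjacency_op_apply[OF assms])
  have *: "cinner (?A x) z = cinner x (?A z)" if "finite_supp z" for z
  proof -
    define F where "F = {v. ell2_fun z v \<noteq> 0}"
    have z: "z = (\<Sum>v\<in>F. cscale (ell2_fun z v) (delta v))"
      using that by (intro finite_supp_expand) (auto simp: F_def finite_supp_def)
    have "?A z = (\<Sum>v\<in>F. cscale (ell2_fun z v) (?A (delta v)))"
      using complex_linear_adjacency_op[OF assms]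
      by (subst z) (simp add: blinfun.sum_right complex_linear_def)
    then show ?thesis
      by (subst z) (simp add: cinner_sum_right cinner_cscale_right delta)
  qed
  obtain z where z: "\<And>n. finite_supp (z n)" "\<And>n. norm (y - z n) < inverse (real (Suc n))"
    using finite_supp_seq[of "\<lambda>n. inverse (real (Suc n))" y] by auto
  have "(\<lambda>n. z n - y) \<longlonglongrightarrow> 0"
    using z(2) by (intro Lim_null_comparison[OF _ LIMSEQ_inverse_real_of_nat] always_eventually)
      (auto simp: norm_minus_commute intro: less_imp_le)
  then have lim: "z \<longlonglongrightarrow> y" by (rule LIM_zero_cancel)
  have "(\<lambda>n. cinner (?A x) (z n)) \<longlonglongrightarrow> cinner (?A x) y"
    by (intro tendsto_cinner tendsto_const lim)
  moreover have "(\<lambda>n. cinner (?A x) (z n)) \<longlonglongrightarrow> cinner x (?A y)"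
    unfolding *[OF z(1)] by (intro tendsto_cinner tendsto_const blinfun.tendsto lim)
  ultimately show ?thesis by (rule LIMSEQ_unique)
qed

text \<open>Weighted arithmetic-geometric mean inequality for the product of |a - b| and |a| + |b|.
  The free weight \<open>r\<close> lets a small difference pay for making the second term
  small.\<close>

lemma cmod_sq_diff_le:
  assumes "0 < r"
  shows "\<bar>(cmod a)\<^sup>2 - (cmod b)\<^sup>2\<bar> \<le> r * (cmod (a - b))\<^sup>2 + ((cmod a)\<^sup>2 + (cmod b)\<^sup>2) / r"
proof -
  define d s where "d = cmod (a - b)" and "s = cmod a + cmod b"
  have "\<bar>cmod a - cmod b\<bar> \<le> d"
    unfolding d_def by (rule norm_triangle_ineq3)
  then have "\<bar>(cmod a)\<^sup>2 - (cmod b)\<^sup>2\<bar> \<le> d * s"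
    using mult_right_mono[of "\<bar>cmod a - cmod b\<bar>" d s]
    by (simp add: power2_eq_square square_diff_square_factored abs_mult s_def mult.commute)
  moreover have "2 * (r * d) * s \<le> (r * d)\<^sup>2 + s\<^sup>2" by (rule sum_squares_bound)
  then have "2 * (d * s) \<le> r * d\<^sup>2 + s\<^sup>2 / r"
    using assms by (simp add: field_simps power2_eq_square)
  moreover have "s\<^sup>2 \<le> 2 * ((cmod a)\<^sup>2 + (cmod b)\<^sup>2)"
    using sum_squares_bound[of "cmod a" "cmod b"] by (simp add: s_def power2_sum)
  then have "s\<^sup>2 / r \<le> 2 * (((cmod a)\<^sup>2 + (cmod b)\<^sup>2) / r)"
    using assms by (simp add: divide_right_mono)
  moreover have "0 \<le> r * d\<^sup>2" using assms by simp
  ultimately show ?thesis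
    unfolding d_def[symmetric] by linarith
qed

text \<open>For each \<open>i\<close>, \<open>\<phi> i v t\<close> is the value at \<open>v\<close>
  of a generalised eigenfunction with eigenvalue \<Phi> t, weighted by \<open>W i t\<close>.
  \<open>orthonormal\<close> is a Parseval identity summed over \<open>i\<close>: the transform is
  isometric but need not be onto, so dependent components are allowed.\<close>

locale eigenfunction_expansion =
  fixes E :: "'v set set" and M :: "'a measure" and \<Phi> :: "'a \<Rightarrow> real" and X :: "real set"
    and W :: "'i::finite \<Rightarrow> 'a \<Rightarrow> real" and \<phi> :: "'i \<Rightarrow> 'v \<Rightarrow> 'a \<Rightarrow> real"
  assumes bounded_degree: "bounded_degree E"
    and compact_X: "compact X"
    and \<Phi>_measurable [measurable]: "\<Phi> \<in> borel_measurable M"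
    and \<Phi>_in: "t \<in> space M \<Longrightarrow> \<Phi> t \<in> X"
    and W_nonneg: "t \<in> space M \<Longrightarrow> 0 \<le> W i t"
    and integrable_W: "integrable M (\<lambda>t. W i t * \<phi> i v t * \<phi> i w t)"
    and eigenfunction: "t \<in> space M \<Longrightarrow> (\<Sum>w | {v, w} \<in> E. \<phi> i w t) = \<Phi> t * \<phi> i v t"
    and orthonormal: "(\<integral>t. (\<Sum>i\<in>UNIV. W i t * \<phi> i v t * \<phi> i w t) \<partial>M) = (if v = w then 1 else 0)"
begin

abbreviation "A \<equiv> adjacency_op E"

definition \<rho> :: "'v \<Rightarrow> 'v \<Rightarrow> 'a \<Rightarrow> real" where
  "\<rho> v w t = (\<Sum>i\<in>UNIV. W i t * \<phi> i v t * \<phi> i w t)"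

lemma integrable_\<rho>: "integrable M (\<rho> v w)"
  unfolding \<rho>_def by (intro Bochner_Integration.integrable_sum integrable_W)

lemma poly_bound:
  obtains b where "0 \<le> b" "\<And>t. t \<in> space M \<Longrightarrow> cmod (poly p (complex_of_real (\<Phi> t))) \<le> b"
proof -
  have "compact ((\<lambda>x. poly p (complex_of_real x)) ` X)"
    by (intro compact_continuous_image compact_X continuous_intros)
  then obtain b where "\<forall>x\<in>X. cmod (poly p (complex_of_real x)) \<le> b"
    using compact_imp_bounded[of "(\<lambda>x. poly p (complex_of_real x)) ` X"] by (auto simp: bounded_iff)
  then have b: "\<And>x. x \<in> X \<Longrightarrow> cmod (poly p (complex_of_real x)) \<le> b"
    by blast
  show thesis
  proof (rule that[of "max 0 b"])
    fix t assume "t \<in> space M"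
    then show "cmod (poly p (complex_of_real (\<Phi> t))) \<le> max 0 b"
      using b[OF \<Phi>_in] by (simp add: le_max_iff_disj)
  qed simp
qed

lemma poly_\<Phi>_measurable [measurable]: "(\<lambda>t. poly p (complex_of_real (\<Phi> t))) \<in> borel_measurable M"
proof -
  have "poly p \<in> borel_measurable borel"
    by (intro borel_measurable_continuous_onI continuous_intros)
  then show ?thesis by measurable
qed

lemma integrable_poly:
  assumes "integrable M D"
  shows "integrable M (\<lambda>t. poly p (complex_of_real (\<Phi> t)) * complex_of_real (D t))"
proof -
  obtain b where b: "0 \<le> b" "\<And>t. t \<in> space M \<Longrightarrow> cmod (poly p (complex_of_real (\<Phi> t))) \<le> b"
    using poly_bound[of p] by blast
  note [measurable] = borel_measurable_integrable[OF assms]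
  show ?thesis
  proof (rule Bochner_Integration.integrable_bound)
    show "integrable M (\<lambda>t. b * D t)" using assms by simp
    show "AE t in M. cmod (poly p (complex_of_real (\<Phi> t)) * complex_of_real (D t)) \<le> norm (b * D t)"
      using b by (intro AE_I2) (simp add: norm_mult abs_mult mult_right_mono)
  qed measurable
qed

text \<open>Each induction step moves one factor of the operator onto \<open>delta v\<close>; the
  eigenfunction equation turns the resulting sum over neighbours into a factor \<Phi> under the
  integral.\<close>

lemma moments_delta:
  "cinner (op_power A n (delta v)) (delta w)
    = (\<integral>t. (complex_of_real (\<Phi> t)) ^ n * complex_of_real (\<rho> v w t) \<partial>M)"
proof (induction n arbitrary: v)
  case 0
  have "cinner (delta v) (delta w) = complex_of_real (if v = w then 1 else 0)"
    by (simp add: cinner_delta_right ell2_fun_delta)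
  moreover have "(\<integral>t. \<rho> v w t \<partial>M) = (if v = w then 1 else 0)"
    using orthonormal[of v w] by (simp add: \<rho>_def)
  ultimately show ?case by simp
next
  case (Suc n)
  have int: "integrable M (\<lambda>t. (complex_of_real (\<Phi> t)) ^ n * complex_of_real (\<rho> u w t))" for u
    using integrable_poly[OF integrable_\<rho>, of "monom 1 n"] by (simp add: poly_monom)
  have "cinner (op_power A (Suc n) (delta v)) (delta w)
      = (\<Sum>u | {v, u} \<in> E. cinner (op_power A n (delta u)) (delta w))"
    by (simp add: op_power_Suc' adjacency_op_delta[OF bounded_degree] blinfun.sum_right cinner_sum_left)
  also have "\<dots> = (\<integral>t. (\<Sum>u | {v, u} \<in> E. (complex_of_real (\<Phi> t)) ^ n * complex_of_real (\<rho> u w t)) \<partial>M)"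
    by (simp add: Suc Bochner_Integration.integral_sum int)
  also have "\<dots> = (\<integral>t. (complex_of_real (\<Phi> t)) ^ Suc n * complex_of_real (\<rho> v w t) \<partial>M)"
  proof (rule Bochner_Integration.integral_cong[OF refl])
    fix t assume t: "t \<in> space M"
    have "(\<Sum>u | {v, u} \<in> E. \<rho> u w t) = (\<Sum>i\<in>UNIV. W i t * (\<Sum>u | {v, u} \<in> E. \<phi> i u t) * \<phi> i w t)"
      unfolding \<rho>_def by (subst sum.swap) (simp add: sum_distrib_left sum_distrib_right)
    also have "\<dots> = \<Phi> t * \<rho> v w t"
      unfolding \<rho>_def eigenfunction[OF t] by (simp add: sum_distrib_left algebra_simps)
    finally show "(\<Sum>u | {v, u} \<in> E. (complex_of_real (\<Phi> t)) ^ n * complex_of_real (\<rho> u w t))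
        = (complex_of_real (\<Phi> t)) ^ Suc n * complex_of_real (\<rho> v w t)"
      by (simp flip: sum_distrib_left of_real_sum)
  qed
  finally show ?case .
qed

lemma poly_delta:
  "cinner (op_poly p A (delta v)) (delta w)
    = (\<integral>t. poly p (complex_of_real (\<Phi> t)) * complex_of_real (\<rho> v w t) \<partial>M)"
proof -
  have int: "integrable M (\<lambda>t. coeff p i * ((complex_of_real (\<Phi> t)) ^ i * complex_of_real (\<rho> v w t)))" for i
    using integrable_poly[OF integrable_\<rho>, of "monom 1 i"] by (simp add: poly_monom)
  have "cinner (op_poly p A (delta v)) (delta w)
      = (\<Sum>i\<le>degree p. (\<integral>t. coeff p i * ((complex_of_real (\<Phi> t)) ^ i * complex_of_real (\<rho> v w t)) \<partial>M))"
    by (simp add: op_poly_apply[OF order_refl] cinner_sum_left cinner_cscale_left moments_delta)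
  also have "\<dots> = (\<integral>t. (\<Sum>i\<le>degree p. coeff p i * ((complex_of_real (\<Phi> t)) ^ i * complex_of_real (\<rho> v w t))) \<partial>M)"
    by (simp only: Bochner_Integration.integral_sum[OF int])
  finally show ?thesis
    by (simp add: poly_altdef sum_distrib_right mult.assoc)
qed

section \<open>Densities of finitely supported vectors and their limits\<close>

definition transform :: "'i \<Rightarrow> 'v ell2 \<Rightarrow> 'a \<Rightarrow> complex" where
  "transform i x t = (\<Sum>v | ell2_fun x v \<noteq> 0. ell2_fun x v * complex_of_real (\<phi> i v t))"

text \<open>A sum over an infinite set is 0 by convention, so \<open>transform\<close>, and with it
  \<open>dens\<close>, carries meaning for finitely supported vectors only.\<close>

definition dens :: "'v ell2 \<Rightarrow> 'a \<Rightarrow> real" where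
  "dens x t = (\<Sum>i\<in>UNIV. W i t * (cmod (transform i x t))\<^sup>2)"

lemma transform_eq:
  assumes "finite F" "{v. ell2_fun x v \<noteq> 0} \<subseteq> F"
  shows "transform i x t = (\<Sum>v\<in>F. ell2_fun x v * complex_of_real (\<phi> i v t))"
  unfolding transform_def using assms by (intro sum.mono_neutral_left) auto

lemma transform_diff:
  assumes "finite_supp x" "finite_supp y"
  shows "transform i (x - y) t = transform i x t - transform i y t"
proof -
  let ?F = "{v. ell2_fun x v \<noteq> 0} \<union> {v. ell2_fun y v \<noteq> 0}"
  have "finite ?F" using assms by (simp add: finite_supp_def)
  moreover have "{v. ell2_fun (x - y) v \<noteq> 0} \<subseteq> ?F" by (auto simp: minus_ell2.rep_eq)
  ultimately show ?thesis
    by (simp add: transform_eq[of ?F] minus_ell2.rep_eq sum_subtractf left_diff_distrib)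
qed

lemma dens_nonneg: "t \<in> space M \<Longrightarrow> 0 \<le> dens x t"
  unfolding dens_def by (intro sum_nonneg mult_nonneg_nonneg W_nonneg) auto

lemma dens_eq:
  "complex_of_real (dens x t)
    = (\<Sum>v | ell2_fun x v \<noteq> 0. \<Sum>w | ell2_fun x w \<noteq> 0.
        ell2_fun x v * cnj (ell2_fun x w) * complex_of_real (\<rho> v w t))"
proof -
  have "complex_of_real (dens x t) = (\<Sum>i\<in>UNIV. complex_of_real (W i t) * (transform i x t * cnj (transform i x t)))"
    by (simp add: dens_def complex_norm_square[symmetric])
  also have "\<dots> = (\<Sum>i\<in>UNIV. \<Sum>v | ell2_fun x v \<noteq> 0. \<Sum>w | ell2_fun x w \<noteq> 0.
      ell2_fun x v * cnj (ell2_fun x w) * complex_of_real (W i t * \<phi> i v t * \<phi> i w t))"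
    unfolding transform_def cnj_sum complex_cnj_mult complex_cnj_complex_of_real of_real_mult
    unfolding sum_product unfolding sum_distrib_left
    by (intro sum.cong refl) (simp add: mult.assoc mult.left_commute)
  also have "\<dots> = (\<Sum>v | ell2_fun x v \<noteq> 0. \<Sum>i\<in>UNIV. \<Sum>w | ell2_fun x w \<noteq> 0.
      ell2_fun x v * cnj (ell2_fun x w) * complex_of_real (W i t * \<phi> i v t * \<phi> i w t))"
    by (rule sum.swap)
  also have "\<dots> = (\<Sum>v | ell2_fun x v \<noteq> 0. \<Sum>w | ell2_fun x w \<noteq> 0. \<Sum>i\<in>UNIV.
      ell2_fun x v * cnj (ell2_fun x w) * complex_of_real (W i t * \<phi> i v t * \<phi> i w t))"
    by (intro sum.cong refl sum.swap)
  finally show ?thesis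
    by (simp add: \<rho>_def sum_distrib_left)
qed

lemma dens_delta: "dens (delta v) t = \<rho> v v t"
proof -
  have "complex_of_real (dens (delta v) t) = complex_of_real (\<rho> v v t)"
    unfolding dens_eq by (simp add: ell2_fun_delta)
  then show ?thesis by (simp only: of_real_eq_iff)
qed

lemma integrable_dens: "integrable M (dens x)"
proof -
  have "integrable M (\<lambda>t. complex_of_real (dens x t))"
    unfolding dens_eq
    by (intro Bochner_Integration.integrable_sum integrable_mult_right integrable_of_real integrable_\<rho>)
  then show ?thesis by (simp only: complex_of_real_integrable_eq)
qed

lemma cinner_op_poly_finite_supp:
  assumes "finite_supp x"
  shows "cinner (op_poly p A x) x = (\<integral>t. poly p (complex_of_real (\<Phi> t)) * complex_of_real (dens x t) \<partial>M)"
proof -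
  define F where "F = {v. ell2_fun x v \<noteq> 0}"
  have x: "x = (\<Sum>v\<in>F. cscale (ell2_fun x v) (delta v))"
    using assms by (intro finite_supp_expand) (auto simp: F_def finite_supp_def)
  have lin: "complex_linear (op_poly p A)"
    by (intro complex_linear_op_poly complex_linear_adjacency_op bounded_degree)
  let ?h = "\<lambda>v w t. poly p (complex_of_real (\<Phi> t)) * complex_of_real (\<rho> v w t)"
  have int: "integrable M (\<lambda>t. ell2_fun x v * cnj (ell2_fun x w) * ?h v w t)" for v w
    by (intro integrable_mult_right integrable_poly integrable_\<rho>)
  have "cinner (op_poly p A x) x
      = cinner (op_poly p A (\<Sum>v\<in>F. cscale (ell2_fun x v) (delta v))) (\<Sum>v\<in>F. cscale (ell2_fun x v) (delta v))"
    using x by simp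
  also have "\<dots> = (\<Sum>w\<in>F. \<Sum>v\<in>F. \<integral>t. ell2_fun x v * cnj (ell2_fun x w) * ?h v w t \<partial>M)"
    using lin
    by (simp add: blinfun.sum_right complex_linear_def cinner_sum_left cinner_sum_right cinner_cscale_left
        cinner_cscale_right poly_delta sum_distrib_left mult.assoc mult.left_commute)
  also have "\<dots> = (\<Sum>v\<in>F. \<Sum>w\<in>F. \<integral>t. ell2_fun x v * cnj (ell2_fun x w) * ?h v w t \<partial>M)"
    by (rule sum.swap)
  also have "\<dots> = (\<integral>t. (\<Sum>v\<in>F. \<Sum>w\<in>F. ell2_fun x v * cnj (ell2_fun x w) * ?h v w t) \<partial>M)"
    by (simp only: Bochner_Integration.integral_sum int Bochner_Integration.integrable_sum)
  also have "\<dots> = (\<integral>t. poly p (complex_of_real (\<Phi> t)) * complex_of_real (dens x t) \<partial>M)"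
    unfolding dens_eq F_def[symmetric] by (simp add: sum_distrib_left algebra_simps)
  finally show ?thesis .
qed

lemma integral_dens: "finite_supp x \<Longrightarrow> (\<integral>t. dens x t \<partial>M) = (norm x)\<^sup>2"
proof -
  assume "finite_supp x"
  from cinner_op_poly_finite_supp[OF this, of 1] have "complex_of_real ((norm x)\<^sup>2) = complex_of_real (\<integral>t. dens x t \<partial>M)"
    by (simp add: cinner_eq_norm)
  then show ?thesis by (simp only: of_real_eq_iff)
qed

lemma dens_diff_le:
  assumes "finite_supp x" "finite_supp y" "0 < r" "t \<in> space M"
  shows "\<bar>dens x t - dens y t\<bar> \<le> r * dens (x - y) t + (dens x t + dens y t) / r"
proof -
  have "\<bar>dens x t - dens y t\<bar> \<le> (\<Sum>i\<in>UNIV. W i t * \<bar>(cmod (transform i x t))\<^sup>2 - (cmod (transform i y t))\<^sup>2\<bar>)"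
    unfolding dens_def sum_subtractf[symmetric] right_diff_distrib[symmetric]
    using W_nonneg[OF assms(4)] by (intro order_trans[OF sum_abs]) (simp add: abs_mult)
  also have "\<dots> \<le> (\<Sum>i\<in>UNIV. W i t * (r * (cmod (transform i (x - y) t))\<^sup>2
      + ((cmod (transform i x t))\<^sup>2 + (cmod (transform i y t))\<^sup>2) / r))"
    unfolding transform_diff[OF assms(1,2)]
    by (intro sum_mono mult_left_mono cmod_sq_diff_le assms W_nonneg)
  also have "\<dots> = r * dens (x - y) t + (dens x t + dens y t) / r"
    unfolding dens_def
    by (simp add: sum.distrib sum_distrib_left sum_divide_distrib algebra_simps add_divide_distrib)
  finally show ?thesis .
qed

text \<open>
  The densities of finitely supported vectors converging fast to \<open>x\<close> form a Cauchy sequence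
  in \<open>L\<^sup>1\<close> with summable increments, so they converge almost everywhere under an integrable majorant.
\<close>

lemma ex_spectral_density: "\<exists>D. spectral_density A M \<Phi> x D"
proof -
  obtain y where fs: "\<And>n. finite_supp (y n)" and y: "\<And>n. norm (x - y n) < (1 / 4) ^ n"
    using finite_supp_seq[of "\<lambda>n. (1 / 4) ^ n" x] by auto
  define d where "d n = dens (y n)" for n
  \<comment> \<open>The bound of \<open>dens_diff_le\<close> with r = 2^n. The squared increments
    are of order 16^-n and absorb the factor 2^n; the division by 2^n makes the bounded masses
    summable.\<close>
  define g where "g n t = 2 ^ n * dens (y (Suc n) - y n) t + (d (Suc n) t + d n t) / 2 ^ n" for n t
  have intd: "integrable M (d n)" for n unfolding d_def by (rule integrable_dens)
  note [measurable] = borel_measurable_integrable[OF intd]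
  have intg: "integrable M (g n)" for n
    unfolding g_def using integrable_dens intd by auto
  note [measurable] = borel_measurable_integrable[OF intg]
  have d0: "0 \<le> d n t" if "t \<in> space M" for n t
    unfolding d_def by (rule dens_nonneg[OF that])
  have g0: "0 \<le> g n t" if "t \<in> space M" for n t
    unfolding g_def using d0[OF that] dens_nonneg[OF that] by simp
  have dg: "\<bar>d (Suc n) t - d n t\<bar> \<le> g n t" if "t \<in> space M" for n t
    unfolding g_def d_def by (rule dens_diff_le) (use fs that in auto)
  have norm_y: "norm (y n) \<le> norm x + 1" for n
  proof -
    have "(1 / 4 :: real) ^ n \<le> 1" by (simp add: power_le_one)
    with y[of n] show ?thesis
      using norm_triangle_ineq[of "y n - x" x] by (simp add: norm_minus_commute)
  qed
  \<comment> \<open>The 4 comes from the increments, of norm at most 2 * (1/4)^n, and the rest from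
    two masses, each at most (norm x + 1)^2.\<close>
  define c where "c = 4 + 2 * (norm x + 1)\<^sup>2"
  have int_g: "(\<integral>t. g n t \<partial>M) \<le> c * (1 / 2) ^ n" for n
  proof -
    have "(\<integral>t. g n t \<partial>M) = 2 ^ n * (norm (y (Suc n) - y n))\<^sup>2 + ((norm (y (Suc n)))\<^sup>2 + (norm (y n))\<^sup>2) / 2 ^ n"
      unfolding g_def d_def using integrable_dens
      by (simp add: integral_dens finite_supp_diff fs)
    moreover have "2 ^ n * (norm (y (Suc n) - y n))\<^sup>2 \<le> 4 * (1 / 2) ^ n"
    proof -
      have "norm (y (Suc n) - y n) \<le> 2 * (1 / 4) ^ n"
      proof -
        have "norm (y (Suc n) - y n) \<le> norm (x - y n) + norm (x - y (Suc n))"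
          using norm_triangle_ineq4[of "x - y n" "x - y (Suc n)"] by simp
        also have "\<dots> \<le> (1 / 4) ^ n + (1 / 4) ^ Suc n"
          using y[of n] y[of "Suc n"] by simp
        also have "\<dots> \<le> 2 * (1 / 4) ^ n" by simp
        finally show ?thesis .
      qed
      then have "(norm (y (Suc n) - y n))\<^sup>2 \<le> (2 * (1 / 4) ^ n)\<^sup>2"
        by (rule power_mono) simp
      then have "2 ^ n * (norm (y (Suc n) - y n))\<^sup>2 \<le> 2 ^ n * (2 * (1 / 4) ^ n)\<^sup>2"
        by (intro mult_left_mono) auto
      also have "\<dots> = 4 * (2 * (1 / 4 * (1 / 4))) ^ n"
        unfolding power_mult_distrib by (simp add: power2_eq_square)
      also have "\<dots> \<le> 4 * (1 / 2) ^ n"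
        by (intro mult_left_mono power_mono) auto
      finally show ?thesis .
    qed
    moreover have "((norm (y (Suc n)))\<^sup>2 + (norm (y n))\<^sup>2) / 2 ^ n \<le> ((norm x + 1)\<^sup>2 + (norm x + 1)\<^sup>2) / 2 ^ n"
      by (intro divide_right_mono add_mono power_mono norm_y) auto
    moreover have "c * (1 / 2) ^ n = 4 * (1 / 2) ^ n + ((norm x + 1)\<^sup>2 + (norm x + 1)\<^sup>2) / 2 ^ n"
      by (simp add: c_def power_one_over field_simps)
    ultimately show ?thesis by linarith
  qed
  have int_g0: "0 \<le> (\<integral>t. g n t \<partial>M)" for n
    using g0 by (intro integral_nonneg_AE AE_I2) auto
  have sum_int: "summable (\<lambda>n. \<integral>t. g n t \<partial>M)"
  proof (rule summable_comparison_test[OF _ summable_mult[OF summable_geometric]])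
    show "\<exists>N. \<forall>n\<ge>N. norm (\<integral>t. g n t \<partial>M) \<le> c * (1 / 2) ^ n"
      using int_g int_g0 by auto
  qed simp
  have summable: "AE t in M. summable (\<lambda>n. g n t)"
  proof -
    have "(\<integral>\<^sup>+t. (\<Sum>n. ennreal (g n t)) \<partial>M) = (\<Sum>n. \<integral>\<^sup>+t. ennreal (g n t) \<partial>M)"
      by (rule nn_integral_suminf) measurable
    also have "\<dots> = (\<Sum>n. ennreal (\<integral>t. g n t \<partial>M))"
      using g0 intg by (subst nn_integral_eq_integral) (auto intro: AE_I2)
    also have "\<dots> \<noteq> \<infinity>"
      using ennreal_suminf_neq_top[OF sum_int int_g0] by simp
    finally have "AE t in M. (\<Sum>n. ennreal (g n t)) \<noteq> \<infinity>"
      by (intro nn_integral_noteq_infinite) auto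
    with AE_space show ?thesis
    proof eventually_elim
      fix t assume "t \<in> space M" "(\<Sum>n. ennreal (g n t)) \<noteq> \<infinity>"
      then show "summable (\<lambda>n. g n t)"
        using g0 by (intro summable_suminf_not_top) auto
    qed
  qed
  have intG: "integrable M (\<lambda>t. \<Sum>n. g n t)"
  proof (rule integrable_suminf[OF intg])
    show "AE t in M. summable (\<lambda>n. norm (g n t))"
      using summable AE_space
    proof eventually_elim
      case (elim t)
      then show ?case using g0 by simp
    qed
    have "(\<integral>t. norm (g n t) \<partial>M) = (\<integral>t. g n t \<partial>M)" for n
      using g0 by (intro Bochner_Integration.integral_cong) auto
    then show "summable (\<lambda>n. \<integral>t. norm (g n t) \<partial>M)" using sum_int by simp
  qed
  \<comment> \<open>The absolute value makes \<open>D\<close> nonnegative also on the null set where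
    the limit may fail to exist.\<close>
  define D where "D t = \<bar>lim (\<lambda>n. d n t)\<bar>" for t
  have D_meas [measurable]: "D \<in> borel_measurable M"
    unfolding D_def by measurable
  define w where "w t = d 0 t + (\<Sum>n. g n t)" for t
  have intw: "integrable M w"
    unfolding w_def by (intro Bochner_Integration.integrable_add intd intG)
  have AE: "AE t in M. (\<lambda>n. d n t) \<longlonglongrightarrow> D t \<and> (\<forall>n. d n t \<le> w t)"
    using summable AE_space
  proof eventually_elim
    case (elim t)
    note t = elim(2)
    have tele: "d n t = d 0 t + (\<Sum>k<n. d (Suc k) t - d k t)" for n
      using sum_lessThan_telescope[of "\<lambda>k. d k t" n] by simp
    have "summable (\<lambda>n. d (Suc n) t - d n t)"
      using dg[OF t] by (intro summable_comparison_test[OF _ elim(1)]) auto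
    then have "(\<lambda>n. d 0 t + (\<Sum>k<n. d (Suc k) t - d k t)) \<longlonglongrightarrow> d 0 t + (\<Sum>n. d (Suc n) t - d n t)"
      by (intro tendsto_intros summable_LIMSEQ)
    then have conv: "(\<lambda>n. d n t) \<longlonglongrightarrow> d 0 t + (\<Sum>n. d (Suc n) t - d n t)"
      by (simp only: tele[symmetric])
    have "0 \<le> lim (\<lambda>n. d n t)"
      using limI[OF conv] LIMSEQ_le_const[OF conv, of 0] d0[OF t] by auto
    then have "(\<lambda>n. d n t) \<longlonglongrightarrow> D t"
      using conv limI[OF conv] by (simp add: D_def)
    moreover have "d n t \<le> w t" for n
    proof -
      have "d n t \<le> d 0 t + (\<Sum>k<n. g k t)"
        unfolding tele[of n] using dg[OF t] by (intro add_left_mono sum_mono) (auto simp: abs_le_iff)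
      also have "\<dots> \<le> w t"
        unfolding w_def using g0[OF t] elim(1) by (intro add_left_mono sum_le_suminf) auto
      finally show ?thesis .
    qed
    ultimately show ?case by blast
  qed
  have intD: "integrable M D"
  proof (rule integrable_dominated_convergence[where s = d and w = w])
    show "AE t in M. (\<lambda>n. d n t) \<longlonglongrightarrow> D t" using AE by eventually_elim blast
    show "AE t in M. norm (d n t) \<le> w t" for n
      using AE AE_space by eventually_elim (use d0 in auto)
  qed (use intw in auto)
  have "cinner (op_poly p A x) x = (\<integral>t. poly p (complex_of_real (\<Phi> t)) * complex_of_real (D t) \<partial>M)" for p
  proof -
    obtain b where b: "0 \<le> b" "\<And>t. t \<in> space M \<Longrightarrow> cmod (poly p (complex_of_real (\<Phi> t))) \<le> b"
      using poly_bound[of p] by blast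
    have "(\<lambda>n. \<integral>t. poly p (complex_of_real (\<Phi> t)) * complex_of_real (d n t) \<partial>M)
      \<longlonglongrightarrow> (\<integral>t. poly p (complex_of_real (\<Phi> t)) * complex_of_real (D t) \<partial>M)"
    proof (rule integral_dominated_convergence[where w = "\<lambda>t. b * w t"])
      show "AE t in M. (\<lambda>n. poly p (complex_of_real (\<Phi> t)) * complex_of_real (d n t))
          \<longlonglongrightarrow> poly p (complex_of_real (\<Phi> t)) * complex_of_real (D t)"
        using AE by eventually_elim (auto intro!: tendsto_intros)
      show "AE t in M. norm (poly p (complex_of_real (\<Phi> t)) * complex_of_real (d n t)) \<le> b * w t" for n
        using AE AE_space
      proof eventually_elim
        case (elim t)
        then show ?case using b d0[of t n] by (auto simp: norm_mult intro!: mult_mono)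
      qed
    qed (use intw in auto)
    then have lim: "(\<lambda>n. cinner (op_poly p A (y n)) (y n)) 
        \<longlonglongrightarrow> (\<integral>t. poly p (complex_of_real (\<Phi> t)) * complex_of_real (D t) \<partial>M)"
      by (simp only: cinner_op_poly_finite_supp[OF fs] d_def)
    have zero: "(\<lambda>n. (1 / 4 :: real) ^ n) \<longlonglongrightarrow> 0" by (rule LIMSEQ_power_zero) simp
    have "(\<lambda>n. y n - x) \<longlonglongrightarrow> 0"
      by (rule Lim_null_comparison[OF _ zero])
        (use y in \<open>auto simp: norm_minus_commute intro!: always_eventually less_imp_le\<close>)
    then have "y \<longlonglongrightarrow> x" by (rule LIM_zero_cancel)
    then have "(\<lambda>n. cinner (op_poly p A (y n)) (y n)) \<longlonglongrightarrow> cinner (op_poly p A x) x"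
      by (intro tendsto_cinner tendsto_const blinfun.tendsto)
    then show ?thesis using lim by (rule LIMSEQ_unique)
  qed
  then have "spectral_density A M \<Phi> x D"
    using intD unfolding spectral_density_def by (auto simp: D_def)
  then show ?thesis by blast
qed

lemma spectral_density_delta: "spectral_density A M \<Phi> (delta v) (\<rho> v v)"
proof -
  have "dens (delta v) = \<rho> v v" by (rule ext) (rule dens_delta)
  then show ?thesis
    unfolding spectral_density_def
    using integrable_\<rho> dens_nonneg[of _ "delta v"] cinner_op_poly_finite_supp[OF finite_supp_delta, of _ v] by simp
qed

text \<open>The density of the vertex serves twice: being positive almost everywhere it dominates
  all others, and it witnesses \<open>essential\<close> at each point of \<open>X\<close> whose
  neighbourhoods \<Phi> hits with positive measure.\<close>

theorem dominant_vertexI: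
  assumes pos: "AE t in M. 0 < \<rho> v v t"
    and ess: "\<And>s e. s \<in> X \<Longrightarrow> 0 < e \<Longrightarrow> \<not> (AE t in M. e \<le> \<bar>\<Phi> t - s\<bar>)"
  shows "dominant_vertex E v"
proof -
  interpret spectral_representation A M \<Phi> X
  proof
    fix s e :: real assume "s \<in> X" "0 < e"
    have "\<not> (AE t in M. \<bar>\<Phi> t - s\<bar> < e \<longrightarrow> \<rho> v v t = 0)"
    proof
      assume "AE t in M. \<bar>\<Phi> t - s\<bar> < e \<longrightarrow> \<rho> v v t = 0"
      with pos have "AE t in M. e \<le> \<bar>\<Phi> t - s\<bar>" by eventually_elim auto
      with ess[OF \<open>s \<in> X\<close> \<open>0 < e\<close>] show False by blast
    qed
    then show "\<exists>x D. spectral_density A M \<Phi> x D \<and> \<not> (AE t in M. \<bar>\<Phi> t - s\<bar> < e \<longrightarrow> D t = 0)"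
      using spectral_density_delta by blast
  qed (use bounded_degree compact_X \<Phi>_in ex_spectral_density in
      \<open>auto intro: complex_linear_adjacency_op adjacency_op_self_adjoint\<close>)
  show ?thesis
    unfolding dominant_vertex_def
    using absolutely_continuous_local_spectral_measure[OF spectral_density_delta pos] by blast
qed

end

section \<open>The spectral weights of the star\<close>

text \<open>\<open>cheb n x\<close> is U_{n-1}(x/2). With this shift the index is the distance from
  the core, and the value 0 at index 0 is the boundary condition for vectors vanishing at the
  core.\<close>

fun cheb :: "nat \<Rightarrow> real \<Rightarrow> real" where
  "cheb 0 x = 0"
| "cheb (Suc 0) x = 1"
| "cheb (Suc (Suc n)) x = x * cheb (Suc n) x - cheb n x"

text \<open>Stated without division by sin t, so that it holds at the endpoints 0 and pi
  too.\<close>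

lemma cheb_cos: "cheb n (2 * cos t) * sin t = sin (real n * t)"
proof (induction n "2 * cos t" rule: cheb.induct)
  case (3 n)
  have "sin (real (Suc (Suc n)) * t) + sin (real n * t) = 2 * cos t * sin (real (Suc n) * t)"
    using sin_plus_sin[of "real (Suc (Suc n)) * t" "real n * t"]
    by (simp add: algebra_simps add_divide_distrib)
  with 3 show ?case by (simp add: algebra_simps)
qed auto

lemma continuous_on_cheb [continuous_intros]: "continuous_on S (cheb n)"
proof (induction n rule: less_induct)
  case (less n)
  consider "n = 0" | "n = 1" | k where "n = Suc (Suc k)"
    by (metis One_nat_def not0_implies_Suc)
  then show ?case
  proof cases
    case 3
    then show ?thesis
      using less[of k] less[of "Suc k"] by (simp add: fun_eq_iff continuous_intros cong: continuous_on_cong)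
  qed (auto simp: cheb.simps[abs_def])
qed

text \<open>With q = k - 1 these are the monic orthogonal polynomials of the invariant part; they
  have squared norm q + 1 = k from index 1 on.\<close>

fun radial :: "real \<Rightarrow> nat \<Rightarrow> real \<Rightarrow> real" where
  "radial q 0 x = 1"
| "radial q (Suc n) x = cheb (Suc (Suc n)) x - q * cheb n x"

lemma radial_Suc_Suc:
  "x * radial q n x = radial q (Suc n) x + (if n = 0 then 0 else if n = 1 then q + 1 else 1) * radial q (n - 1) x"
  by (cases n; cases "n - 1") (auto simp: algebra_simps)

lemma continuous_on_radial [continuous_intros]: "continuous_on S (radial q n)"
proof (cases n)
  case (Suc m)
  have "radial q (Suc m) = (\<lambda>x. cheb (Suc (Suc m)) x - q * cheb m x)" by (simp add: fun_eq_iff)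
  then show ?thesis unfolding Suc by (simp only: continuous_intros)
qed (simp add: radial.simps[abs_def])

text \<open>At x = a + b with a b = 1 the recurrence is solved by the powers of a and of b; the
  condition b^2 = q is exactly what removes the powers of b. For |b| > 1 the remaining solution
  decays, so a + b is an eigenvalue.\<close>

lemma radial_eigenvalue:
  assumes "a * b = 1" "b\<^sup>2 = q"
  shows "radial q (Suc n) (a + b) = (q + 1) * a ^ Suc n"
proof (induction n rule: less_induct)
  case (less n)
  have ab: "a * b = 1" "q = b * b"
    using assms by (simp_all add: power2_eq_square)
  consider "n = 0" | "n = 1" | k where "n = Suc (Suc k)"
    by (metis One_nat_def not0_implies_Suc)
  then show ?case
  proof cases
    case 1
    have "q * a = (a * b) * b"
      unfolding ab(2) by simp
    then have "q * a = b" using ab(1) by simp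
    then show ?thesis using 1 by (simp add: algebra_simps)
  next
    case 2
    have "(a + b) * (a + b) - 1 - q = a * a + 1"
      using assms by (simp add: power2_eq_square algebra_simps)
    moreover have "q * (a * a) = 1"
      using assms by (metis mult.assoc mult.commute mult_1 power2_eq_square)
    ultimately show ?thesis using 2 by (simp add: algebra_simps power2_eq_square)
  next
    case 3
    have "radial q (Suc n) (a + b) = (a + b) * ((q + 1) * a ^ Suc (Suc k)) - (q + 1) * a ^ Suc k"
      using less[of k] less[of "Suc k"] radial_Suc_Suc[of "a + b" q "Suc (Suc k)"] 3 by simp
    also have "\<dots> = (q + 1) * (a * a ^ Suc (Suc k) + (a * b - 1) * a ^ Suc k)"
      by (simp add: algebra_simps)
    finally show ?thesis using 3 assms by simp
  qed
qed

section \<open>Integration against the semicircle law\<close>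

definition ray_density :: "real \<Rightarrow> real" where "ray_density t = 2 / pi * (sin t)\<^sup>2"

text \<open>The substitution x = 2 cos t carries the semicircle law sqrt (4 - x^2) / (2 pi) dx to (2
  / pi) sin^2 t dt on [0, pi].\<close>

definition ray_integral :: "(real \<Rightarrow> real) \<Rightarrow> real" where
  "ray_integral F = integral {0..pi} (\<lambda>t. ray_density t * F (2 * cos t))"

lemma ray_integral_integrable:
  assumes "continuous_on {-2..2} F"
  shows "(\<lambda>t. ray_density t * F (2 * cos t)) integrable_on {0..pi}"
  unfolding ray_density_def
  by (intro integrable_continuous_real continuous_intros continuous_on_compose2[OF assms]) auto

lemma ray_integral_add: "continuous_on {-2..2} F \<Longrightarrow> continuous_on {-2..2} G \<Longrightarrow> ray_integral (\<lambda>x. F x + G x) = ray_integral F + ray_integral G"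
  unfolding ray_integral_def by (simp add: distrib_left ray_integral_integrable Henstock_Kurzweil_Integration.integral_add)

lemma ray_integral_cmult: "ray_integral (\<lambda>x. c * F x) = c * ray_integral F"
  unfolding ray_integral_def by (simp add: mult.left_commute[of _ c])

lemma ray_integral_cong: "(\<And>x. x \<in> {-2..2} \<Longrightarrow> F x = G x) \<Longrightarrow> ray_integral F = ray_integral G"
  unfolding ray_integral_def by (intro integral_cong) auto

lemma ray_integral_reflect:
  assumes "continuous_on {-2..2} F"
  shows "ray_integral (\<lambda>x. F (- x)) = ray_integral F"
proof -
  have "((\<lambda>t. ray_density t * F (2 * cos t)) has_integral ray_integral F) (cbox 0 pi)"
    unfolding ray_integral_def using ray_integral_integrable[OF assms] by (simp add: has_integral_integral)
  from has_integral_affinity[OF this, of "-1" pi]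
  have "((\<lambda>t. ray_density t * F (- (2 * cos t))) has_integral ray_integral F) {0..pi}"
    by (simp add: ray_density_def image_affinity_atLeastAtMost_diff)
  then show ?thesis unfolding ray_integral_def by (rule integral_unique)
qed

lemma integral_cos_int: "((\<lambda>t. cos (real_of_int j * t)) has_integral (if j = 0 then pi else 0)) {0..pi}"
proof (cases "j = 0")
  case True
  then show ?thesis using has_integral_const_real[of "1::real" 0 pi] by simp
next
  case False
  have "((\<lambda>t. cos (real_of_int j * t)) has_integral
      sin (real_of_int j * pi) / real_of_int j - sin (real_of_int j * 0) / real_of_int j) {0..pi}"
  proof (rule fundamental_theorem_of_calculus)
    fix t
    have "((\<lambda>t. sin (real_of_int j * t) / real_of_int j) has_field_derivative cos (real_of_int j * t)) (at t within {0..pi})"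
      using False by (auto intro!: derivative_eq_intros)
    then show "((\<lambda>t. sin (real_of_int j * t) / real_of_int j) has_vector_derivative cos (real_of_int j * t)) (at t within {0..pi})"
      by (simp add: has_real_derivative_iff_has_vector_derivative)
  qed simp
  then show ?thesis using False by (simp add: sin_npi_int mult.commute)
qed

text \<open>The product of two sines splits into cosines of the integer frequencies n - m and n + m.
  For n = m = 0 both frequencies vanish and the contributions cancel.\<close>

lemma ray_integral_cheb: "ray_integral (\<lambda>x. cheb n x * cheb m x) = (if n = m \<and> 0 < n then 1 else 0)"
proof -
  let ?j = "int n - int m" and ?l = "int n + int m"
  have eq: "ray_density t * (cheb n (2 * cos t) * cheb m (2 * cos t))
      = 1 / pi * (cos (real_of_int ?j * t) - cos (real_of_int ?l * t))" for t
  proof -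
    have "ray_density t * (cheb n (2 * cos t) * cheb m (2 * cos t)) = 2 / pi * (sin (real n * t) * sin (real m * t))"
      unfolding ray_density_def cheb_cos[symmetric] by (simp add: power2_eq_square)
    then show ?thesis by (simp add: sin_times_sin left_diff_distrib distrib_right diff_divide_distrib)
  qed
  have "((\<lambda>t. 1 / pi * (cos (real_of_int ?j * t) - cos (real_of_int ?l * t))) has_integral
      1 / pi * ((if ?j = 0 then pi else 0) - (if ?l = 0 then pi else 0))) {0..pi}"
    by (intro has_integral_mult_right has_integral_diff integral_cos_int)
  then have "ray_integral (\<lambda>x. cheb n x * cheb m x) = 1 / pi * ((if ?j = 0 then pi else 0) - (if ?l = 0 then pi else 0))"
    unfolding ray_integral_def eq by (rule integral_unique)
  then show ?thesis by auto
qed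

text \<open>
  The parameter space: \<open>[0, pi]\<close> carries the continuous spectrum through \<open>x = 2 cos t\<close>, and the
  unit intervals \<open>(pi, pi + 1]\<close> and \<open>(pi + 1, pi + 2]\<close> replace the two point masses.
\<close>

definition arc :: "real measure" where
  "arc = density lborel (\<lambda>t. ennreal (indicator {0..pi + 2} t))"

definition pieces :: "(real \<Rightarrow> real) \<Rightarrow> real \<Rightarrow> real \<Rightarrow> real \<Rightarrow> real" where
  "pieces g a b t = (if t \<le> pi then g t else if t \<le> pi + 1 then a else b)"

lemma pieces_measurable:
  assumes "continuous_on UNIV g"
  shows "pieces g a b \<in> borel_measurable borel"
proof -
  have [measurable]: "g \<in> borel_measurable borel"
    using assms by (rule borel_measurable_continuous_onI)
  show ?thesis unfolding pieces_def by measurable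
qed

lemma has_bochner_integral_pieces:
  assumes g: "continuous_on UNIV g"
  shows "has_bochner_integral arc (pieces g a b) (integral {0..pi} g + a + b)"
  unfolding arc_def
proof (rule has_bochner_integral_density)
  have gc: "continuous_on {0..pi} g" using g by (rule continuous_on_subset) simp
  have "has_bochner_integral lborel (\<lambda>t. indicator {0..pi} t *\<^sub>R g t) (integral {0..pi} g)"
    using borel_integrable_atLeastAtMost'[OF gc] set_borel_integral_eq_integral(2)[OF borel_integrable_atLeastAtMost'[OF gc]]
    by (simp add: has_bochner_integral_iff set_integrable_def set_lebesgue_integral_def)
  moreover have "has_bochner_integral lborel (\<lambda>t. a * indicator {pi<..pi + 1} t) (a * 1)"
    "has_bochner_integral lborel (\<lambda>t. b * indicator {pi + 1<..pi + 2} t) (b * 1)"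
    by (intro has_bochner_integral_mult_right; simp add: has_bochner_integral_iff)+
  ultimately have "has_bochner_integral lborel (\<lambda>t. indicator {0..pi} t *\<^sub>R g t
      + a * indicator {pi<..pi + 1} t + b * indicator {pi + 1<..pi + 2} t) (integral {0..pi} g + a * 1 + b * 1)"
    by (intro has_bochner_integral_add)
  moreover have "(\<lambda>t. indicator {0..pi} t *\<^sub>R g t + a * indicator {pi<..pi + 1} t + b * indicator {pi + 1<..pi + 2} t)
      = (\<lambda>t. indicator {0..pi + 2} t *\<^sub>R pieces g a b t)"
  proof (rule ext)
    fix t :: real
    have "\<not> t \<le> pi \<Longrightarrow> 0 \<le> t" "\<not> t \<le> pi + 1 \<Longrightarrow> 0 \<le> t"
      using pi_gt_zero by linarith+
    then show "indicator {0..pi} t *\<^sub>R g t + a * indicator {pi<..pi + 1} t + b * indicator {pi + 1<..pi + 2} t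
      = indicator {0..pi + 2} t *\<^sub>R pieces g a b t"
      by (auto simp: pieces_def indicator_def)
  qed
  ultimately show "has_bochner_integral lborel (\<lambda>t. indicator {0..pi + 2} t *\<^sub>R pieces g a b t) (integral {0..pi} g + a + b)"
    by simp
qed (use pieces_measurable[OF g] in auto)

definition W_ray :: "real \<Rightarrow> real" where
  "W_ray = pieces ray_density 0 0"

lemma continuous_on_ray_density: "continuous_on S ray_density"
  unfolding ray_density_def by (intro continuous_intros)

lemma W_ray_nonneg: "0 \<le> W_ray t"
  by (simp add: W_ray_def pieces_def ray_density_def)

lemma AE_arc_iff: "(AE t in arc. Q t) \<longleftrightarrow> (AE t in lborel. t \<in> {0..pi + 2} \<longrightarrow> Q t)"
  unfolding arc_def by (subst AE_density) (auto simp: indicator_def)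

lemma not_AE_avoids_interval:
  assumes "c < (d :: real)"
  shows "\<not> (AE t in lborel. t \<notin> {c..d})"
proof
  assume "AE t in lborel. t \<notin> {c..d}"
  then have "emeasure lborel {c..d} = 0"
    by (subst (asm) AE_iff_measurable[of "{c..d}"]) auto
  with assms show False by (simp add: ennreal_eq_0_iff)
qed

section \<open>The spectral measure of the core\<close>

locale star_weights =
  fixes q :: real
  assumes q: "2 \<le> q"
begin

text \<open>This is a + b of \<open>radial_eigenvalue\<close> for b = sqrt q. Since lam^2 - 4 = (q -
  1)^2 / q, it lies outside [-2, 2].\<close>

definition lam :: real where "lam = (q + 1) / sqrt q"

lemma lam_sq: "lam\<^sup>2 = (q + 1)\<^sup>2 / q"
  using q by (simp add: lam_def power_divide)

lemma lam_sq_gt: "4 < lam\<^sup>2"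
proof -
  have "lam\<^sup>2 - 4 = (q - 1)\<^sup>2 / q"
    using q unfolding lam_sq by (simp add: field_simps power2_eq_square)
  moreover have "0 < (q - 1)\<^sup>2 / q" using q by simp
  ultimately show ?thesis by linarith
qed

text \<open>If m is the Stieltjes transform of the semicircle law, that of the core is 1 / (z - k
  m(z)). At x = 2 cos t the boundary values of m have modulus 1 and |x - k m|^2 = q (lam^2 - x^2).
  Hence the core has density (q + 1) / q times \<open>resolvent\<close> with respect to the
  semicircle law.\<close>

definition resolvent :: "real \<Rightarrow> real" where "resolvent x = 1 / (lam\<^sup>2 - x\<^sup>2)"

lemma sq_le_4: "x \<in> {-2..2} \<Longrightarrow> x\<^sup>2 \<le> (4::real)"
  using power2_le_iff_abs_le[of 2 x] by (auto simp: abs_le_iff)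

lemma resolvent_denominator: "x \<in> {-2..2} \<Longrightarrow> lam\<^sup>2 - x\<^sup>2 > 0"
  using sq_le_4[of x] lam_sq_gt by linarith

lemma continuous_on_resolvent: "continuous_on {-2..2} resolvent"
  unfolding resolvent_def using resolvent_denominator by (intro continuous_intros) (metis less_irrefl)

text \<open>The common mass of the two eigenvalues \<open>\<plusminus> lam\<close> at the core, chosen to give total mass 1.\<close>

definition mass :: real where "mass = (1 - (q + 1) / q * ray_integral resolvent) / 2"

text \<open>Replacing lam^2 by 4 bounds the integrand by the constant 1 / (2 pi). The bound 1/2
  already gives positive \<open>mass\<close>, since (q + 1) / (2 q) < 1.\<close>

lemma ray_integral_resolvent_le: "ray_integral resolvent \<le> 1 / 2"
proof -
  have "ray_integral resolvent \<le> integral {0..pi} (\<lambda>t. 1 / (2 * pi))"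
    unfolding ray_integral_def
  proof (rule integral_le)
    fix t :: real
    have "4 * (sin t)\<^sup>2 \<le> lam\<^sup>2 - (2 * cos t)\<^sup>2"
      using lam_sq_gt by (simp add: sin_squared_eq power_mult_distrib)
    then have "(sin t)\<^sup>2 / (lam\<^sup>2 - (2 * cos t)\<^sup>2) \<le> 1 / 4"
      using resolvent_denominator[of "2 * cos t"] by (simp add: divide_le_eq)
    from mult_left_mono[OF this, of "2 / pi"]
    show "ray_density t * resolvent (2 * cos t) \<le> 1 / (2 * pi)"
      by (simp add: ray_density_def resolvent_def)
  qed (use ray_integral_integrable[OF continuous_on_resolvent] in auto)
  also have "\<dots> = 1 / 2" by simp
  finally show ?thesis .
qed

lemma mass_pos: "0 < mass"
proof -
  have "(q + 1) / q * ray_integral resolvent \<le> (q + 1) / q * (1 / 2)"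
    using q ray_integral_resolvent_le by (intro mult_left_mono) auto
  also have "\<dots> < 1" using q by (simp add: field_simps)
  finally show ?thesis by (simp add: mass_def)
qed

definition core_integral :: "(real \<Rightarrow> real) \<Rightarrow> real" where
  "core_integral F = (q + 1) / q * ray_integral (\<lambda>x. resolvent x * F x) + mass * (F lam + F (- lam))"

lemma core_integral_add:
  assumes "continuous_on UNIV F" "continuous_on UNIV G"
  shows "core_integral (\<lambda>x. F x + G x) = core_integral F + core_integral G"
proof -
  have "continuous_on {-2..2} (\<lambda>x. resolvent x * F x)" "continuous_on {-2..2} (\<lambda>x. resolvent x * G x)"
    by (intro continuous_intros continuous_on_resolvent continuous_on_subset[OF assms(1)]
        continuous_on_subset[OF assms(2)]; simp)+
  then show ?thesis
    unfolding core_integral_def by (simp add: distrib_left ray_integral_add algebra_simps)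
qed

lemma core_integral_cmult: "core_integral (\<lambda>x. c * F x) = c * core_integral F"
  unfolding core_integral_def using ray_integral_cmult[of c "\<lambda>x. resolvent x * F x"] by (simp add: algebra_simps)

text \<open>The factor lam^2 - x^2 vanishes at both atoms and cancels \<open>resolvent\<close>,
  leaving a semicircle integral. It is the only bridge from \<open>core_integral\<close> to
  integrals that are known explicitly.\<close>

lemma core_integral_resolvent: "core_integral (\<lambda>x. (lam\<^sup>2 - x\<^sup>2) * F x) = (q + 1) / q * ray_integral F"
proof -
  have "ray_integral (\<lambda>x. resolvent x * ((lam\<^sup>2 - x\<^sup>2) * F x)) = ray_integral F"
  proof (rule ray_integral_cong)
    fix x :: real assume "x \<in> {-2..2}"
    then show "resolvent x * ((lam\<^sup>2 - x\<^sup>2) * F x) = F x"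
      using resolvent_denominator[of x] by (simp add: resolvent_def)
  qed
  then show ?thesis by (simp add: core_integral_def)
qed

lemma core_integral_sq_mult:
  assumes "continuous_on UNIV F"
  shows "core_integral (\<lambda>x. x\<^sup>2 * F x) = lam\<^sup>2 * core_integral F - (q + 1) / q * ray_integral F"
proof -
  have "core_integral (\<lambda>x. x\<^sup>2 * F x + (lam\<^sup>2 - x\<^sup>2) * F x) = core_integral (\<lambda>x. x\<^sup>2 * F x) + core_integral (\<lambda>x. (lam\<^sup>2 - x\<^sup>2) * F x)"
    by (rule core_integral_add) (intro continuous_intros assms)+
  moreover have "(\<lambda>x. x\<^sup>2 * F x + (lam\<^sup>2 - x\<^sup>2) * F x) = (\<lambda>x. lam\<^sup>2 * F x)"
    by (simp add: fun_eq_iff algebra_simps)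
  ultimately show ?thesis by (simp add: core_integral_cmult core_integral_resolvent)
qed

lemma core_integral_radial_0: "core_integral (radial q 0) = 1"
proof -
  have "X + (1 - X) / 2 * (1 + 1) = 1" for X :: real by (simp add: field_simps)
  then show ?thesis unfolding core_integral_def mass_def radial.simps mult_1_right by blast
qed

lemma core_integral_radial_1: "core_integral (radial q 1) = 0"
proof -
  have c: "continuous_on {-2..2} (\<lambda>x. resolvent x * x)"
    by (intro continuous_intros continuous_on_resolvent)
  have "ray_integral (\<lambda>x. resolvent x * x) = ray_integral (\<lambda>x. resolvent (- x) * (- x))"
    using ray_integral_reflect[OF c] by simp
  also have "\<dots> = ray_integral (\<lambda>x. (- 1) * (resolvent x * x))" by (simp add: resolvent_def)
  also have "\<dots> = - ray_integral (\<lambda>x. resolvent x * x)" by (subst ray_integral_cmult) simp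
  finally show ?thesis by (simp add: core_integral_def)
qed

abbreviation P where "P \<equiv> radial q"

lemma ray_integral_radial: "ray_integral (P n) = (if n = 0 then 1 else if n = 2 then - q else 0)"
proof (cases n)
  case 0
  have "P 0 = (\<lambda>x. 1)" by (simp add: fun_eq_iff)
  then show ?thesis using 0 ray_integral_cheb[of 1 1] by simp
next
  case (Suc m)
  have "ray_integral (P (Suc m)) = ray_integral (\<lambda>x. cheb (Suc (Suc m)) x * cheb 1 x + (- q) * (cheb m x * cheb 1 x))"
    by (intro arg_cong[of _ _ ray_integral] ext) simp
  also have "\<dots> = ray_integral (\<lambda>x. cheb (Suc (Suc m)) x * cheb 1 x) + (- q) * ray_integral (\<lambda>x. cheb m x * cheb 1 x)"
    by (subst ray_integral_add) (auto intro!: continuous_intros simp: ray_integral_cmult[symmetric])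
  finally show ?thesis using Suc by (simp add: ray_integral_cheb del: cheb.simps)
qed

text \<open>Expanding x^2 P_n in the P_j and applying \<open>core_integral_sq_mult\<close> gives a
  recurrence of step 2 for these integrals. Its inhomogeneous term is nonzero only at n = 0 and n =
  2: cancellation at 2 accounts for the factor (q + 1) / q, cancellation at 0 for the value of
  lam^2.\<close>

lemma core_integral_radial: "core_integral (P n) = (if n = 0 then 1 else 0)"
proof -
  have lin3: "core_integral (\<lambda>x. P i x + a * P j x + b * P l x) = core_integral (P i) + a * core_integral (P j) + b * core_integral (P l)" for i j l a b
    by (subst core_integral_add, (intro continuous_intros)+, subst core_integral_add, (intro continuous_intros)+) (simp add: core_integral_cmult)
  have sq: "core_integral (\<lambda>x. x\<^sup>2 * P n x) = lam\<^sup>2 * core_integral (P n) - (q + 1) / q * ray_integral (P n)" for n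
    by (rule core_integral_sq_mult) (intro continuous_intros)
  have x2: "x\<^sup>2 * P n x = x * (x * P n x)" for n x by (simp add: power2_eq_square)
  have s0: "x\<^sup>2 * P 0 x = P 2 x + (q + 1) * P 0 x + 0 * P 0 x" for x
    using radial_Suc_Suc[of x q 0] radial_Suc_Suc[of x q 1] unfolding x2 by (simp add: numeral_2_eq_2 del: radial.simps)
  have s1: "x\<^sup>2 * P 1 x = P 3 x + (q + 2) * P 1 x + 0 * P 0 x" for x
    using radial_Suc_Suc[of x q 0] radial_Suc_Suc[of x q 1] radial_Suc_Suc[of x q 2] unfolding x2
    by (simp add: numeral_2_eq_2 numeral_3_eq_3 algebra_simps del: radial.simps)
  have s2: "x\<^sup>2 * P 2 x = P 4 x + 2 * P 2 x + (q + 1) * P 0 x" for x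
    using radial_Suc_Suc[of x q 1] radial_Suc_Suc[of x q 2] radial_Suc_Suc[of x q 3] unfolding x2
    by (simp add: numeral_eq_Suc algebra_simps del: radial.simps)
  \<comment> \<open>From index 3 on, the exceptional coefficient q + 1 of the recurrence no longer
    enters; the lower indices are expanded one by one.\<close>
  have s3: "x\<^sup>2 * P (n + 3) x = P (n + 5) x + 2 * P (n + 3) x + 1 * P (n + 1) x" for x n
    using radial_Suc_Suc[of x q "n + 2"] radial_Suc_Suc[of x q "n + 3"] radial_Suc_Suc[of x q "n + 4"] unfolding x2
    by (simp add: numeral_eq_Suc algebra_simps del: radial.simps)
  have J2: "core_integral (P 2) = 0"
    using sq[of 0] q unfolding s0 lin3 core_integral_radial_0 ray_integral_radial lam_sq
    by (simp add: field_simps power2_eq_square)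
  have J3: "core_integral (P 3) = 0"
    using sq[of 1] unfolding s1 lin3 core_integral_radial_1 ray_integral_radial by simp
  have J4: "core_integral (P 4) = 0"
    using sq[of 2] q unfolding s2 lin3 J2 core_integral_radial_0 ray_integral_radial by simp
  have "core_integral (P (Suc n)) = 0" for n
  proof (induction n rule: less_induct)
    case (less n)
    consider "n = 0" | "n = 1" | "n = 2" | "n = 3" | k where "n = k + 4"
    proof -
      have "n = 0 \<or> n = 1 \<or> n = 2 \<or> n = 3 \<or> n = (n - 4) + 4" by linarith
      then show thesis using that by blast
    qed
    then show ?case
    proof cases
      case (5 k)
      then show ?thesis
        using sq[of "k + 3"] less[of k] less[of "k + 2"] unfolding s3 lin3 ray_integral_radial
          by (simp add: numeral_eq_Suc del: radial.simps)
    qed (use core_integral_radial_1 J2 J3 J4 in \<open>simp_all add: numeral_eq_Suc del: radial.simps\<close>)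
  qed
  then show ?thesis using core_integral_radial_0 by (cases n) auto
qed

text \<open>Multiplication by x may be attached to either factor, so the recurrence lowers n at the
  price of raising m; hence m is arbitrary in the induction. The case n = 0 is
  \<open>core_integral_radial\<close>.\<close>

lemma radial_orthogonal:
  "core_integral (\<lambda>x. P n x * P m x) = (if n = m then if n = 0 then 1 else q + 1 else 0)"
proof (induction n arbitrary: m rule: less_induct)
  case (less n)
  \<comment> \<open>The value 0 at index 0 cancels the term in which the truncated i - 1 would
    wrongly repeat \<open>P 0\<close>.\<close>
  define c where "c i = (if i = 0 then 0 else if i = 1 then q + 1 else 1)" for i :: nat
  have rec: "x * P i x = P (Suc i) x + c i * P (i - 1) x" for i x
    unfolding c_def by (rule radial_Suc_Suc)
  have lin: "core_integral (\<lambda>x. P i x * P j x + a * (P k x * P l x)) = core_integral (\<lambda>x. P i x * P j x) + a * core_integral (\<lambda>x. P k x * P l x)"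
    for i j k l a
    by (subst core_integral_add, (intro continuous_intros)+) (simp add: core_integral_cmult)
  show ?case
  proof (cases n)
    case 0
    then show ?thesis using core_integral_radial[of m] by simp
  next
    case (Suc i)
    have "core_integral (\<lambda>x. P (Suc i) x * P m x + c i * (P (i - 1) x * P m x)) = core_integral (\<lambda>x. P i x * P (Suc m) x + c m * (P i x * P (m - 1) x))"
    proof (rule arg_cong[of _ _ core_integral], rule ext)
      fix x
      have "(x * P i x) * P m x = P i x * (x * P m x)" by simp
      then show "P (Suc i) x * P m x + c i * (P (i - 1) x * P m x) = P i x * P (Suc m) x + c m * (P i x * P (m - 1) x)"
        unfolding rec by (simp add: algebra_simps del: radial.simps)
    qed
    then have "core_integral (\<lambda>x. P (Suc i) x * P m x) = core_integral (\<lambda>x. P i x * P (Suc m) x)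
        + c m * core_integral (\<lambda>x. P i x * P (m - 1) x) - c i * core_integral (\<lambda>x. P (i - 1) x * P m x)"
      unfolding lin by simp
    moreover have "core_integral (\<lambda>x. P i x * P j x) = (if i = j then if i = 0 then 1 else q + 1 else 0)" for j
      by (rule less) (simp add: Suc)
    moreover have "core_integral (\<lambda>x. P (i - 1) x * P j x) = (if i - 1 = j then if i - 1 = 0 then 1 else q + 1 else 0)" for j
      by (rule less) (simp add: Suc)
    ultimately have "core_integral (\<lambda>x. P (Suc i) x * P m x) = (if i = Suc m then if i = 0 then 1 else q + 1 else 0)
        + c m * (if i = m - 1 then if i = 0 then 1 else q + 1 else 0)
        - c i * (if i - 1 = m then if i - 1 = 0 then 1 else q + 1 else 0)"
      by (simp only:)
    then show ?thesis
      using Suc by (cases m; cases i) (auto simp: c_def simp del: radial.simps)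
  qed
qed

section \<open>Transfer to the parameter space\<close>

definition energy :: "real \<Rightarrow> real" where
  "energy = pieces (\<lambda>t. 2 * cos t) lam (- lam)"

definition W_core :: "real \<Rightarrow> real" where
  "W_core = pieces (\<lambda>t. (q + 1) / q * (ray_density t * resolvent (2 * cos t))) mass mass"

lemma continuous_on_resolvent_cos: "continuous_on S (\<lambda>t. resolvent (2 * cos t))"
  by (rule continuous_on_compose2[OF continuous_on_resolvent]) (auto intro!: continuous_intros)

lemma energy_measurable: "energy \<in> borel_measurable arc"
proof -
  have "energy \<in> borel_measurable borel"
    unfolding energy_def by (rule pieces_measurable) (intro continuous_intros)
  then show ?thesis by (simp add: arc_def)
qed

lemma has_bochner_integral_ray:
  assumes "continuous_on UNIV F"
  shows "has_bochner_integral arc (\<lambda>t. W_ray t * F (energy t)) (ray_integral F)"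
proof -
  have "(\<lambda>t. W_ray t * F (energy t)) = pieces (\<lambda>t. ray_density t * F (2 * cos t)) 0 0"
    by (auto simp: fun_eq_iff W_ray_def energy_def pieces_def)
  moreover have "continuous_on UNIV (\<lambda>t. ray_density t * F (2 * cos t))"
    by (intro continuous_intros continuous_on_ray_density continuous_on_compose2[OF assms]) auto
  ultimately show ?thesis
    using has_bochner_integral_pieces[of "\<lambda>t. ray_density t * F (2 * cos t)" 0 0] by (simp add: ray_integral_def)
qed

lemma has_bochner_integral_core:
  assumes "continuous_on UNIV F"
  shows "has_bochner_integral arc (\<lambda>t. W_core t * F (energy t)) (core_integral F)"
proof -
  let ?g = "\<lambda>t. (q + 1) / q * (ray_density t * (resolvent (2 * cos t) * F (2 * cos t)))"
  have "(\<lambda>t. W_core t * F (energy t)) = pieces ?g (mass * F lam) (mass * F (- lam))"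
    by (auto simp: fun_eq_iff W_core_def energy_def pieces_def)
  moreover have "continuous_on UNIV ?g"
    by (intro continuous_intros continuous_on_ray_density continuous_on_resolvent_cos continuous_on_compose2[OF assms]) auto
  moreover have "integral {0..pi} ?g = (q + 1) / q * ray_integral (\<lambda>x. resolvent x * F x)"
    unfolding ray_integral_def by (rule integral_mult_right)
  then have "integral {0..pi} ?g + mass * F lam + mass * F (- lam) = core_integral F"
    by (simp add: core_integral_def distrib_left)
  ultimately show ?thesis
    using has_bochner_integral_pieces[of ?g "mass * F lam" "mass * F (- lam)"] by (simp only:)
qed

lemma resolvent_cos_pos: "0 < resolvent (2 * cos t)"
  using resolvent_denominator[of "2 * cos t"] by (simp add: resolvent_def)

lemma W_core_nonneg: "0 \<le> W_core t"
  using mass_pos resolvent_cos_pos[of t] q by (simp add: W_core_def pieces_def ray_density_def)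

definition levels :: "real set" where "levels = {-2..2} \<union> {lam, - lam}"

lemma compact_levels: "compact levels"
  unfolding levels_def by (intro compact_Un) auto

lemma energy_in_levels: "energy t \<in> levels"
  using abs_cos_le_one[of t] by (auto simp: energy_def pieces_def levels_def abs_le_iff)

text \<open>Each neighbourhood of a level has a preimage containing a nondegenerate interval: at the
  atoms because \<open>energy\<close> is constant there, on [-2, 2] by continuity of the
  cosine.\<close>

lemma energy_essential:
  assumes "s \<in> levels" "0 < e"
  shows "\<not> (AE t in arc. e \<le> \<bar>energy t - s\<bar>)"
proof
  assume "AE t in arc. e \<le> \<bar>energy t - s\<bar>"
  then have AE: "AE t in lborel. t \<in> {0..pi + 2} \<longrightarrow> e \<le> \<bar>energy t - s\<bar>"
    by (simp add: AE_arc_iff)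
  have "\<exists>c d. c < d \<and> {c..d} \<subseteq> {0..pi + 2} \<and> (\<forall>t\<in>{c..d}. \<bar>energy t - s\<bar> < e)"
  proof -
    consider "s = lam" | "s = - lam" | "s \<in> {-2..2}"
      using assms(1) unfolding levels_def by blast
    then show ?thesis
    proof cases
      case 1
      \<comment> \<open>Starting at pi + 1/2 avoids the endpoint pi, which belongs to the continuous
        piece.\<close>
      then show ?thesis using assms(2)
        by (intro exI[of _ "pi + 1 / 2"] exI[of _ "pi + 1"]) (auto simp: energy_def pieces_def)
    next
      case 2
      then show ?thesis using assms(2)
        by (intro exI[of _ "pi + 3 / 2"] exI[of _ "pi + 2"]) (auto simp: energy_def pieces_def)
    next
      case 3
      define r where "r = arccos (s / 2)"
      have r: "0 \<le> r" "r \<le> pi" "2 * cos r = s"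
        using 3 by (auto simp: r_def arccos_lbound arccos_ubound)
      \<comment> \<open>The function 2 cos has Lipschitz constant 2, so radius e/4 changes it by at
        most e/2; the clipping keeps \<open>t\<close> in [0, pi].\<close>
      have "\<bar>energy t - s\<bar> < e" if "t \<in> {max 0 (r - e / 4)..min pi (r + e / 4)}" for t
      proof -
        have "\<bar>cos t - cos r\<bar> \<le> \<bar>t - r\<bar>"
        proof -
          have "\<bar>cos t - cos r\<bar> = 2 * (\<bar>sin ((t + r) / 2)\<bar> * \<bar>sin ((r - t) / 2)\<bar>)"
            unfolding cos_diff_cos by (simp add: abs_mult)
          also have "\<dots> \<le> 2 * (1 * \<bar>(r - t) / 2\<bar>)"
            by (intro mult_left_mono mult_mono abs_sin_le_one abs_sin_x_le_abs_x) auto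
          finally show ?thesis by (simp add: abs_minus_commute)
        qed
        then show ?thesis
          using that r assms(2) by (auto simp: energy_def pieces_def)
      qed
      moreover have "max 0 (r - e / 4) < min pi (r + e / 4)"
        using r assms(2) pi_gt_zero by auto
      ultimately show ?thesis
        by (intro exI[of _ "max 0 (r - e / 4)"] exI[of _ "min pi (r + e / 4)"]) auto
    qed
  qed
  then obtain c d where cd: "c < d" "{c..d} \<subseteq> {0..pi + 2}" "\<And>t. t \<in> {c..d} \<Longrightarrow> \<bar>energy t - s\<bar> < e"
    by blast
  have "AE t in lborel. t \<notin> {c..d}"
    using AE by eventually_elim (use cd in force)
  with not_AE_avoids_interval[OF cd(1)] show False by blast
qed

text \<open>\<open>radial_eigenvalue\<close> with a = 1/b and b = sqrt q; for - lam both signs are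
  reversed, which preserves a b = 1 and b^2 = q.\<close>

lemma radial_lam: "P (Suc n) lam \<noteq> 0" "P (Suc n) (- lam) \<noteq> 0"
proof -
  define b where "b = sqrt q"
  have b: "b \<noteq> 0" "b\<^sup>2 = q" using q by (auto simp: b_def)
  have lam: "lam = 1 / b + b"
    using b by (simp add: lam_def b_def[symmetric] field_simps power2_eq_square)
  have "P (Suc n) (1 / b + b) = (q + 1) * (1 / b) ^ Suc n"
    by (rule radial_eigenvalue) (use b in auto)
  then show "P (Suc n) lam \<noteq> 0" using b q lam by simp
  have "P (Suc n) (- 1 / b + - b) = (q + 1) * (- 1 / b) ^ Suc n"
    by (rule radial_eigenvalue) (use b in auto)
  then show "P (Suc n) (- lam) \<noteq> 0" using b q lam by simp
qed

end

section \<open>Non-cyclicity\<close>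

lemma exists_two_free_rays:
  fixes v :: "'k::finite star_vertex"
  assumes "CARD('k) \<ge> 3"
  obtains a b :: 'k where "a \<noteq> b" "\<And>n. v \<noteq> Ray a n" "\<And>n. v \<noteq> Ray b n"
proof -
  obtain j where j: "\<And>i n. i \<noteq> j \<Longrightarrow> v \<noteq> Ray i n"
  proof (cases v)
    case (Ray i m)
    then show thesis using that[of i] by simp
  qed simp
  have "\<not> card (UNIV - {j}) \<le> Suc 0"
    using assms by (simp add: card_Diff_singleton)
  then obtain a b where "a \<noteq> j" "b \<noteq> j" "a \<noteq> b"
    unfolding card_le_Suc0_iff_eq[OF finite] by blast
  then show thesis using j that by blast
qed

lemma not_cyclic_star:
  assumes "CARD('k::finite) \<ge> 3"
  shows "\<not> cyclic_vertex (star_edges :: 'k star_vertex set set) v"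
proof
  let ?A = "adjacency_op (star_edges :: 'k star_vertex set set)"
  assume cyclic: "cyclic_vertex (star_edges :: 'k star_vertex set set) v"
  obtain a b :: 'k where ab: "a \<noteq> b" "\<And>n. v \<noteq> Ray a n" "\<And>n. v \<noteq> Ray b n"
    using exists_two_free_rays[OF assms] by blast
  define S where "S = {x :: 'k star_vertex ell2. \<forall>n. ell2_fun x (Ray a n) = ell2_fun x (Ray b n)}"
  have star: "star_vert i n = (if n = 0 then Core else Ray i (n - 1))" for i :: 'k and n
    by (cases n) auto
  \<comment> \<open>The neighbours of \<open>Ray a n\<close> and \<open>Ray b n\<close> correspond
    index by index, and for n = 0 the two rays share the neighbour \<open>Core\<close>.\<close>
  have inv: "?A x \<in> S" if "x \<in> S" for x
    using that unfolding S_def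
    by (simp add: adjacency_op_apply[OF bounded_degree_star] star_neighbours_Ray star)
  have "op_power ?A n (delta v) \<in> S" for n
  proof (induction n)
    case 0
    then show ?case using ab(2,3)[symmetric] by (simp add: S_def ell2_fun_delta)
  qed (simp add: op_power_Suc inv)
  moreover have "ell2.subspace S"
    by (rule ell2.subspaceI) (auto simp: S_def zero_ell2.rep_eq plus_ell2.rep_eq cscale.rep_eq)
  ultimately have "ell2.span (range (\<lambda>n. op_power ?A n (delta v))) \<subseteq> S"
    by (intro ell2.span_minimal) auto
  moreover have "closed S"
    unfolding closed_sequential_limits
  proof (intro allI impI)
    show "l \<in> S" if xl: "(\<forall>n. x n \<in> S) \<and> x \<longlonglongrightarrow> l" for x l
    proof -
      from xl have x: "\<forall>n. x n \<in> S" and lim: "x \<longlonglongrightarrow> l" by auto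
      have conv: "(\<lambda>n. ell2_fun (x n) u) \<longlonglongrightarrow> ell2_fun l u" for u
        using tendsto_cinner[OF lim tendsto_const, of "delta u"] by (simp add: cinner_delta_right)
      have "ell2_fun l (Ray a m) = ell2_fun l (Ray b m)" for m
        using x LIMSEQ_unique[OF conv[of "Ray a m"]] conv[of "Ray b m"] by (simp add: S_def)
      then show ?thesis by (simp add: S_def)
    qed
  qed
  ultimately have "S = UNIV"
    using cyclic closure_minimal unfolding cyclic_vertex_def by blast
  moreover have "delta (Ray a 0) \<notin> S"
    using ab(1) by (auto simp: S_def ell2_fun_delta intro!: exI[of _ 0])
  ultimately show False by blast
qed

section \<open>Dominance\<close>

fun depth :: "'k star_vertex \<Rightarrow> nat" where
  "depth Core = 0"
| "depth (Ray j n) = Suc n"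

text \<open>The invariant projection of a \<delta> off the core spreads it evenly over k rays. The
  factor 1/k, with squared norm k for the radial polynomial, gives this projection its squared norm
  1/k.\<close>

fun radial_coeff :: "'k::finite star_vertex \<Rightarrow> real" where
  "radial_coeff Core = 1"
| "radial_coeff (Ray j n :: 'k star_vertex) = 1 / real CARD('k)"

fun ray_coeff :: "'k::finite \<Rightarrow> 'k star_vertex \<Rightarrow> real" where
  "ray_coeff l Core = 0"
| "ray_coeff l (Ray j n) = (if l = j then 1 else 0) - 1 / real CARD('k)"

text \<open>
  \<open>None\<close> stands for the part of \<open>\<ell>\<^sup>2\<close> invariant under permutations of the rays; the
  components \<open>Some l\<close> together describe its complement, where each \<open>\<delta>\<close> at depth \<open>n\<close> on ray \<open>j\<close> is
  split off by the projection \<open>(\<delta>\<^bsub>lj\<^esub> - 1/k)\<^bsub>l\<^esub>\<close>.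
\<close>

fun star_eigenfunction :: "'k::finite option \<Rightarrow> 'k star_vertex \<Rightarrow> real \<Rightarrow> real" where
  "star_eigenfunction None v x = radial_coeff v * radial (real CARD('k) - 1) (depth v) x"
| "star_eigenfunction (Some l) v x = ray_coeff l v * cheb (depth v) x"

text \<open>The matrix of entries \<delta>_{lj} - 1/k is a symmetric projection, hence equal to its
  own Gram matrix. This makes the k dependent components a Parseval system.\<close>

lemma sum_ray_coeff:
  "(\<Sum>l\<in>UNIV. ray_coeff l (Ray i n) * ray_coeff l (Ray j m)) = (if i = j then 1 else 0) - 1 / real CARD('k)"
  for i j :: "'k::finite"
proof -
  let ?k = "real CARD('k)"
  have "ray_coeff l (Ray i n) * ray_coeff l (Ray j m)
      = (if l = i then (if i = j then 1 else 0) else 0) - (if l = i then 1 / ?k else 0)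
        - (if l = j then 1 / ?k else 0) + 1 / ?k * (1 / ?k)" for l
    by (auto simp: algebra_simps)
  then show ?thesis
    by (simp add: sum.distrib sum_subtractf)
qed

lemma star_eigenfunction_eq:
  "(\<Sum>u | {v, u} \<in> star_edges. star_eigenfunction i u x) = x * star_eigenfunction i v x"
  for v :: "'k::finite star_vertex"
proof (cases v)
  case Core
  have inj: "inj (\<lambda>j :: 'k. Ray j 0)" by (rule injI) simp
  have "(\<Sum>u | {v, u} \<in> star_edges. star_eigenfunction i u x) = (\<Sum>j\<in>UNIV. star_eigenfunction i (Ray j 0) x)"
    unfolding Core star_neighbours_Core by (simp add: sum.reindex[OF inj])
  also have "\<dots> = x * star_eigenfunction i v x"
    using Core by (cases i) (auto simp: sum_subtractf)
  finally show ?thesis .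
next
  case (Ray j n)
  have "(\<Sum>u | {v, u} \<in> star_edges. star_eigenfunction i u x)
      = star_eigenfunction i (star_vert j n) x + star_eigenfunction i (Ray j (Suc n)) x"
    unfolding Ray star_neighbours_Ray by (cases n) auto
  also have "\<dots> = x * star_eigenfunction i v x"
  proof (cases i)
    case None
    have "x * radial (real CARD('k) - 1) (Suc n) x = radial (real CARD('k) - 1) (Suc (Suc n)) x
      + (if n = 0 then real CARD('k) else 1) * radial (real CARD('k) - 1) n x"
      using radial_Suc_Suc[of x "real CARD('k) - 1" "Suc n"] by simp
    then show ?thesis
      using None Ray by (cases n) (simp_all add: field_simps del: radial.simps)
  next
    case (Some l)
    then show ?thesis using Ray by (cases n) (simp_all add: algebra_simps)
  qed
  finally show ?thesis .
qed

lemma continuous_on_star_eigenfunction: "continuous_on S (star_eigenfunction i v)"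
proof (cases i)
  case None
  have "star_eigenfunction None v = (\<lambda>x. radial_coeff v * radial (real CARD('a) - 1) (depth v) x)"
    by (simp add: fun_eq_iff)
  then show ?thesis using None by (simp only: continuous_intros)
next
  case (Some l)
  have "star_eigenfunction (Some l) v = (\<lambda>x. ray_coeff l v * cheb (depth v) x)"
    by (simp add: fun_eq_iff)
  then show ?thesis using Some by (simp only: continuous_intros)
qed

lemma sum_option: "(\<Sum>i\<in>UNIV. f i) = f None + (\<Sum>l\<in>UNIV. f (Some l))"
  for f :: "'k::finite option \<Rightarrow> real"
  by (simp add: UNIV_option_conv sum.reindex)

context star_weights
begin

definition weight :: "'k option \<Rightarrow> real \<Rightarrow> real" where
  "weight i = (case i of None \<Rightarrow> W_core | Some l \<Rightarrow> W_ray)"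

lemma weight_nonneg: "0 \<le> weight i t"
  unfolding weight_def by (cases i) (auto simp: W_core_nonneg W_ray_nonneg)

lemma has_bochner_integral_weight:
  assumes "continuous_on UNIV F"
  shows "has_bochner_integral arc (\<lambda>t. weight i t * F (energy t))
    (case i of None \<Rightarrow> core_integral F | Some l \<Rightarrow> ray_integral F)"
  unfolding weight_def
  by (cases i) (auto simp: has_bochner_integral_core has_bochner_integral_ray assms)

end

lemma star_eigenfunction_expansion:
  assumes "CARD('k::finite) \<ge> 3"
  defines "q \<equiv> real CARD('k) - 1"
  shows "eigenfunction_expansion (star_edges :: 'k star_vertex set set) arc (star_weights.energy q)
    (star_weights.levels q) (star_weights.weight q)
    (\<lambda>i v t. star_eigenfunction i v (star_weights.energy q t))"
proof -
  let ?k = "real CARD('k)"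
  interpret star_weights q
    using assms by unfold_locales simp
  have k: "q + 1 = ?k" "?k \<noteq> 0" using assms by (auto simp: q_def)
  have int: "has_bochner_integral arc
      (\<lambda>t. weight i t * (star_eigenfunction i v (energy t) * star_eigenfunction i u (energy t)))
      (case i of None \<Rightarrow> core_integral (\<lambda>x. star_eigenfunction i v x * star_eigenfunction i u x)
        | Some l \<Rightarrow> ray_integral (\<lambda>x. star_eigenfunction i v x * star_eigenfunction i u x))"
    for i and u v :: "'k star_vertex"
    by (rule has_bochner_integral_weight) (intro continuous_intros continuous_on_star_eigenfunction)
  have core: "core_integral (\<lambda>x. star_eigenfunction None v x * star_eigenfunction None u x)
      = radial_coeff v * radial_coeff u * (if depth v = depth u then if depth v = 0 then 1 else ?k else 0)"
    for u v :: "'k star_vertex"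
  proof -
    have "(\<lambda>x. star_eigenfunction None v x * star_eigenfunction None u x)
        = (\<lambda>x. radial_coeff v * radial_coeff u * (radial q (depth v) x * radial q (depth u) x))"
      by (simp add: fun_eq_iff q_def)
    then show ?thesis
      by (simp only: core_integral_cmult radial_orthogonal k)
  qed
  have ray: "ray_integral (\<lambda>x. star_eigenfunction (Some l) v x * star_eigenfunction (Some l) u x)
      = ray_coeff l v * ray_coeff l u * (if depth v = depth u \<and> 0 < depth v then 1 else 0)"
    for l and u v :: "'k star_vertex"
  proof -
    have "(\<lambda>x. star_eigenfunction (Some l) v x * star_eigenfunction (Some l) u x)
        = (\<lambda>x. ray_coeff l v * ray_coeff l u * (cheb (depth v) x * cheb (depth u) x))"
      by (simp add: fun_eq_iff)
    then show ?thesis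
      by (simp only: ray_integral_cmult ray_integral_cheb)
  qed
  show ?thesis
  proof
    show "bounded_degree (star_edges :: 'k star_vertex set set)"
      by (rule bounded_degree_star)
    show "compact levels" by (rule compact_levels)
    show "energy \<in> borel_measurable arc" by (rule energy_measurable)
    show "energy t \<in> levels" for t by (rule energy_in_levels)
    show "0 \<le> weight i t" for i :: "'k option" and t by (rule weight_nonneg)
    show "integrable arc (\<lambda>t. weight i t * star_eigenfunction i v (energy t) * star_eigenfunction i u (energy t))"
      for i and u v :: "'k star_vertex"
      using int[of i v u] by (simp add: has_bochner_integral_iff mult.assoc)
    show "(\<Sum>u | {v, u} \<in> star_edges. star_eigenfunction i u (energy t)) = energy t * star_eigenfunction i v (energy t)"
      for i and v :: "'k star_vertex" and t
      by (rule star_eigenfunction_eq)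
    show "(\<integral>t. (\<Sum>i\<in>UNIV. weight i t * star_eigenfunction i v (energy t) * star_eigenfunction i u (energy t)) \<partial>arc)
        = (if v = u then 1 else 0)" for u v :: "'k star_vertex"
    proof -
      have "has_bochner_integral arc
          (\<lambda>t. \<Sum>i\<in>UNIV. weight i t * (star_eigenfunction i v (energy t) * star_eigenfunction i u (energy t)))
          (\<Sum>i\<in>UNIV. case i of None \<Rightarrow> core_integral (\<lambda>x. star_eigenfunction i v x * star_eigenfunction i u x)
            | Some l \<Rightarrow> ray_integral (\<lambda>x. star_eigenfunction i v x * star_eigenfunction i u x))"
        by (intro has_bochner_integral_sum int)
      then have "(\<integral>t. (\<Sum>i\<in>UNIV. weight i t * star_eigenfunction i v (energy t) * star_eigenfunction i u (energy t)) \<partial>arc)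
          = radial_coeff v * radial_coeff u * (if depth v = depth u then if depth v = 0 then 1 else ?k else 0)
            + (\<Sum>l\<in>UNIV. ray_coeff l v * ray_coeff l u * (if depth v = depth u \<and> 0 < depth v then 1 else 0))"
        by (simp only: has_bochner_integral_iff sum_option core ray option.case mult.assoc)
      \<comment> \<open>At equal positive depth the invariant part contributes k / k^2 = 1/k, which
        restores the 1/k subtracted in \<open>sum_ray_coeff\<close>.\<close>
      also have "\<dots> = (if v = u then 1 else 0)"
        using k by (cases v; cases u) (auto simp: sum_ray_coeff simp del: ray_coeff.simps(2))
      finally show ?thesis .
    qed
  qed
qed

lemma dominant_star:
  assumes "CARD('k::finite) \<ge> 3"
  shows "dominant_vertex (star_edges :: 'k star_vertex set set) (Ray j n)"
proof -
  define q where "q = real CARD('k) - 1"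
  interpret star_weights q
    using assms by unfold_locales (simp add: q_def)
  interpret eigenfunction_expansion "star_edges :: 'k star_vertex set set" arc energy levels weight
    "\<lambda>i v t. star_eigenfunction i v (energy t)"
    unfolding q_def by (rule star_eigenfunction_expansion[OF assms])
  let ?v = "Ray j n :: 'k star_vertex"
  \<comment> \<open>All summands of \<open>\<rho>\<close> are nonnegative, so one positive component
    suffices, and it may depend on \<open>t\<close>.\<close>
  have term_le: "weight i t * (star_eigenfunction i ?v (energy t))\<^sup>2 \<le> \<rho> ?v ?v t" for i t
  proof -
    have "weight i t * (star_eigenfunction i ?v (energy t))\<^sup>2
        \<le> (\<Sum>i\<in>UNIV. weight i t * (star_eigenfunction i ?v (energy t))\<^sup>2)"
      by (rule member_le_sum) (auto intro!: mult_nonneg_nonneg weight_nonneg)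
    then show ?thesis by (simp only: \<rho>_def power2_eq_square mult.assoc)
  qed
  have "countable {t. sin (real (Suc n) * t) = 0}"
  proof (rule countable_subset)
    show "{t. sin (real (Suc n) * t) = 0} \<subseteq> range (\<lambda>i :: int. real_of_int i * pi / real (Suc n))"
    proof
      fix t assume "t \<in> {t. sin (real (Suc n) * t) = 0}"
      then obtain i :: int where "real (Suc n) * t = real_of_int i * pi"
        unfolding sin_zero_iff_int2 by blast
      then have "t = real_of_int i * pi / real (Suc n)"
        by (simp add: field_simps del: of_nat_Suc)
      then show "t \<in> range (\<lambda>i :: int. real_of_int i * pi / real (Suc n))" by blast
    qed
  qed simp
  then have "AE t in lborel. t \<notin> {t. sin (real (Suc n) * t) = 0}"
    by (intro AE_not_in countable_imp_null_set_lborel)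
  then have "AE t in arc. 0 < \<rho> ?v ?v t"
    unfolding AE_arc_iff
  proof eventually_elim
    case (elim t)
    show ?case
    proof (cases "t \<le> pi")
      case True
      have "weight (Some j) t * (star_eigenfunction (Some j) ?v (energy t))\<^sup>2
          = 2 / pi * (1 - 1 / real CARD('k))\<^sup>2 * (sin (real (Suc n) * t))\<^sup>2"
        using True unfolding cheb_cos[symmetric]
        by (simp add: weight_def W_ray_def energy_def pieces_def ray_density_def power_mult_distrib del: cheb.simps)
      moreover have "0 < 2 / pi * (1 - 1 / real CARD('k))\<^sup>2 * (sin (real (Suc n) * t))\<^sup>2"
        using elim assms by simp
      ultimately have "0 < \<rho> ?v ?v t" using term_le[of "Some j" t] by linarith
      then show ?thesis by blast
    next
      case False
      \<comment> \<open>Beyond pi the weight \<open>W_ray\<close> is 0, so here positivity has to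
        come from the invariant component, whose weight is \<open>mass\<close>.\<close>
      have "star_eigenfunction None ?v (energy t) = radial q (Suc n) (energy t) / real CARD('k)"
        by (simp add: q_def del: radial.simps)
      then have "star_eigenfunction None ?v (energy t) \<noteq> 0"
        using False radial_lam[of n] by (simp add: energy_def pieces_def del: radial.simps)
      then have "0 < weight (None :: 'k option) t * (star_eigenfunction None ?v (energy t))\<^sup>2"
        using False mass_pos by (simp add: weight_def W_core_def pieces_def del: star_eigenfunction.simps)
      then have "0 < \<rho> ?v ?v t" using term_le[of None t] by linarith
      then show ?thesis by blast
    qed
  qed
  then show ?thesis
    by (rule dominant_vertexI) (rule energy_essential)
qed

theorem theorem7p3:
  assumes "CARD('k::finite) \<ge> 3"
  shows "(\<forall>v. v \<noteq> Core \<longrightarrow> dominant_vertex (star_edges :: 'k star_vertex set set) v) \<and>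
         (\<forall>v. \<not> cyclic_vertex (star_edges :: 'k star_vertex set set) v)"
proof (intro conjI allI impI)
  fix v :: "'k star_vertex"
  assume "v \<noteq> Core"
  then show "dominant_vertex star_edges v"
    using dominant_star[OF assms] by (cases v) auto
qed (rule not_cyclic_star[OF assms])

end
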